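(* Let $\epsilon \le 1/16$. Consider the $(6,3)$-majority algorithm run by $n$ nodes against a late $\epsilon$-bounded adaptive blocking adversary, starting from any initial assignment of values in $\{0,1\}$ to the nodes in which no node is undefined. Then $O(\log n)$ rounds suffice to ensure that, with high probability, all except a constant fraction of the nodes hold the same value.
   Context: Model: $n$ anonymous nodes, every pair of which can communicate directly, operate in synchronous rounds; in each round every node first receives all messages sent to it in the previous round that were not blocked, then performs arbitrary local computation, then sends messages. A late $\epsilon$-bounded adaptive adversary (with unlimited computational power): at the start of each round $t\ge 2$ it observes the complete state of the system at the beginning of round $t-1$, and based on this chooses a set $B_t$ of at most $\epsilon n$ nodes to block in round $t$; a blocked node can neither send nor receive messages in that round, and a node knows whether it is currently blocked. In round 1 the adversary knows the initial state but not the random choices made by the nodes in that round. "With high probability" (w.h.p.) means with probability at least $1-n^{-\Omega(1)}$. The $(k,\ell)$-majority algorithm (integers $k\ge \ell>0$, $\ell$ odd): each node $u$ has a variable $x_u\in\{0,1,\bot\}$; $u$ is undefined if $x_u=\bot$ and defined otherwise. In each round every node $u$ acts as follows. Reset rule: if $u$ received fewer than $\ell$ values from the previous round, or $u$ is blocked, then $u$ sets $x_u:=\bot$ and skips the rest of the round. Update rule: otherwise $u$ picks $\ell$ of the received values uniformly at random, sets $x_u$ to the majority of these $\ell$ values, and sends $x_u$ to $k$ nodes chosen independently and uniformly at random. *)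

theory Defs
  imports "HOL-Probability.Probability"
begin

text \<open>Nodes are 0..n-1. A node value is bool option (None = undefined).
  A configuration at the beginning of a round: the value of every node and,
  for every node, the list of values sent to it in the previous round
  (the messages it will receive in this round, unless it is blocked).\<close>

type_synonym config = "(nat \<Rightarrow> bool option) \<times> (nat \<Rightarrow> bool list)"

definition majority_of :: "bool list \<Rightarrow> nat set \<Rightarrow> bool" where
  "majority_of msgs S = (2 * card {i\<in>S. msgs ! i} > card S)"

text \<open>Local random update of one node: blocked = node is blocked this round;
  first = this is round 1 (no messages from a previous round; unblocked nodes
  keep their initial value and send it).\<close>
definition node_update ::
  "nat \<Rightarrow> bool \<Rightarrow> bool \<Rightarrow> bool option \<Rightarrow> bool list \<Rightarrow> bool option pmf" where
  "node_update l first blocked xu inb =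
     (if blocked then return_pmf None
      else if first then return_pmf xu
      else if length inb < l then return_pmf None
      else map_pmf (\<lambda>S. Some (majority_of inb S))
             (pmf_of_set {S. S \<subseteq> {..<length inb} \<and> card S = l}))"

definition deliver ::
  "nat \<Rightarrow> nat \<Rightarrow> (nat \<Rightarrow> bool option) \<Rightarrow> (nat \<Rightarrow> nat \<Rightarrow> nat) \<Rightarrow> nat \<Rightarrow> bool list" where
  "deliver n k x' tgt v =
     (if v < n then
        concat (map (\<lambda>u. case x' u of None \<Rightarrow> []
                         | Some b \<Rightarrow> replicate (card {j\<in>{..<k}. tgt u j = v}) b) [0..<n])
      else [])"

definition round_step ::
  "nat \<Rightarrow> nat \<Rightarrow> nat \<Rightarrow> bool \<Rightarrow> nat set \<Rightarrow> config \<Rightarrow> config pmf" where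
  "round_step n k l first B c =
     do { x' \<leftarrow> Pi_pmf {..<n} None (\<lambda>u. node_update l first (u \<in> B) (fst c u) (snd c u));
          tgt \<leftarrow> Pi_pmf {..<n} (\<lambda>_. 0) (\<lambda>u. Pi_pmf {..<k} 0 (\<lambda>_. pmf_of_set {..<n}));
          return_pmf (x', deliver n k x' tgt) }"

definition init_config :: "nat \<Rightarrow> (nat \<Rightarrow> bool) \<Rightarrow> config" where
  "init_config n x0 = ((\<lambda>u. if u < n then Some (x0 u) else None), (\<lambda>_. []))"

text \<open>Adversary: given the round number t and its view of the history of
  configurations, chooses the blocked set B_t.  In round t \<ge> 2 the view is
  [S_1, ..., S_(t-1)] (states at the beginning of rounds 1..t-1); in round 1
  it is [S_1] (the initial state).\<close>
type_synonym adversary = "nat \<Rightarrow> config list \<Rightarrow> nat set"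

definition adv_view :: "nat \<Rightarrow> config list \<Rightarrow> config list" where
  "adv_view t h = (if t \<le> 1 then h else butlast h)"

definition eps_bounded :: "nat \<Rightarrow> real \<Rightarrow> adversary \<Rightarrow> bool" where
  "eps_bounded n \<epsilon> adv \<longleftrightarrow>
     (\<forall>t h. adv t h \<subseteq> {..<n} \<and> real (card (adv t h)) \<le> \<epsilon> * real n)"

fun run :: "nat \<Rightarrow> nat \<Rightarrow> nat \<Rightarrow> adversary \<Rightarrow> config \<Rightarrow> nat \<Rightarrow> config list pmf" where
  "run n k l adv S1 0 = return_pmf [S1]"
| "run n k l adv S1 (Suc t) =
     do { h \<leftarrow> run n k l adv S1 t;
          S' \<leftarrow> round_step n k l (t = 0) (adv (Suc t) (adv_view (Suc t) h)) (last h);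
          return_pmf (h @ [S']) }"

end

theory Submission
  imports Defs "HOL-Real_Asymp.Real_Asymp"
begin

text \<open>The blocked set of a round is fixed before the targets of the messages received in that round are
  drawn, so the adversary only influences how many nodes are blocked, and the vectors of values
  form a controlled Markov chain. By exchangeability, the three messages used by a node form a uniformly
  random triple of all messages sent; hence, if the values are biased by $\beta$ among the defined nodes, the
  next bias is in expectation at least $\beta(3-\beta^2)/2$. As the fraction of defined nodes stays above
  $2/3$, the gap between the two values grows in expectation by a factor of at least 1.1 per round as long as
  it is below $0.36n$, whereas its variance is $O(n)$ by a bounded difference argument.

  Let $V$ be the minimum of 1 and $K\sqrt n$ divided by the gap. For gaps above $K\sqrt n$,
  Chebyshev's inequality shows that $V$ contracts in expectation by a constant factor. For smaller gaps it does so because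
  linearly many nodes receive exactly two messages of either kind and thus toss independent fair
  coins, which produces a gap of $2K\sqrt n$ with constant probability. Since $V$ is of order at
  least $n^{-1/2}$, it can only survive $O(\log n)$ rounds with polynomially small probability.\<close>

section \<open>Expectations, variance and random walks\<close>

text \<open>Two thresholds have to fit together. If at least 2n/3 nodes are defined, an inbox has
  mean size at least 4 and contains three messages with probability at least 3/4; as 15/16 * 3/4 =
  45/64 exceeds 2/3, the condition renews itself with linear slack. A gap of 0.36n means a bias of
  at most 0.54 among 2n/3 or more defined nodes, small enough for growth by 1.1; yet (2/3 + 0.36)/2
  exceeds 1/2, so meeting both thresholds already makes more than half of all nodes agree. The
  obstacle is the range of gaps of order sqrt n. There Chebyshev's inequality bounds the failure
  probability of a single round only by a constant, and the gap may fall back, so a union bound over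
  the rounds or a division into phases does not work directly. The reciprocal of the gap, truncated
  at 1, is bounded and turns these failures into a small loss in expectation, which the growth
  outweighs.\<close>

lemma expectation_bind_pmf_finite:
  fixes h :: "'b \<Rightarrow> real"
  assumes "finite (set_pmf p)" "\<And>x. x \<in> set_pmf p \<Longrightarrow> finite (set_pmf (f x))"
  shows "measure_pmf.expectation (p \<bind> f) h =
    measure_pmf.expectation p (\<lambda>x. measure_pmf.expectation (f x) h)"
  using assms
  by (subst pmf_expectation_bind[of "set_pmf p"]) (auto simp: integral_measure_pmf[of "set_pmf p"])

lemma expectation_mono_finite:
  fixes f g :: "'a \<Rightarrow> real"
  assumes "finite (set_pmf p)" "\<And>x. x \<in> set_pmf p \<Longrightarrow> f x \<le> g x"
  shows "measure_pmf.expectation p f \<le> measure_pmf.expectation p g"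
  using assms by (intro integral_mono_AE integrable_measure_pmf_finite) (auto simp: AE_measure_pmf_iff)

lemma expectation_le_const:
  fixes f :: "'a \<Rightarrow> real"
  assumes "finite (set_pmf p)" "\<And>x. x \<in> set_pmf p \<Longrightarrow> f x \<le> c"
  shows "measure_pmf.expectation p f \<le> c"
  using expectation_mono_finite[OF assms(1), of f "\<lambda>_. c"] assms(2) by simp

lemma expectation_ge_const:
  fixes f :: "'a \<Rightarrow> real"
  assumes "finite (set_pmf p)" "\<And>x. x \<in> set_pmf p \<Longrightarrow> c \<le> f x"
  shows "c \<le> measure_pmf.expectation p f"
  using expectation_mono_finite[OF assms(1), of "\<lambda>_. c" f] assms(2) by simp

text \<open>Every distribution of the process is built from finite products and binds of finitely
  supported ones; integrability is always obtained from this finiteness.\<close>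

lemma finite_set_pmf_Pi_pmf:
  assumes "finite A" "\<And>x. x \<in> A \<Longrightarrow> finite (set_pmf (p x))"
  shows "finite (set_pmf (Pi_pmf A d p))"
  using assms by (simp add: set_Pi_pmf finite_PiE_dflt)

lemma expectation_Pi_pmf_component:
  fixes g :: "'b \<Rightarrow> real"
  assumes "finite A" "x \<in> A"
  shows "measure_pmf.expectation (Pi_pmf A d p) (\<lambda>f. g (f x)) = measure_pmf.expectation (p x) g"
proof -
  have "measure_pmf.expectation (Pi_pmf A d p) (\<lambda>f. g (f x)) =
      measure_pmf.expectation (map_pmf (\<lambda>f. f x) (Pi_pmf A d p)) g" by simp
  then show ?thesis using assms by (simp only: Pi_pmf_component if_True)
qed

text \<open>The cross term has mean zero. Applied to conditional distributions, this splits a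
  variance along successive random choices.\<close>

lemma expectation_square_split:
  fixes f :: "'a \<Rightarrow> real"
  assumes "finite (set_pmf p)"
  shows "measure_pmf.expectation p (\<lambda>x. (f x - m)\<^sup>2) =
    measure_pmf.expectation p (\<lambda>x. (f x - measure_pmf.expectation p f)\<^sup>2) +
    (measure_pmf.expectation p f - m)\<^sup>2"
proof -
  note [simp] = integrable_measure_pmf_finite[OF assms]
  define e where "e = measure_pmf.expectation p f"
  have "measure_pmf.expectation p (\<lambda>x. (f x - m)\<^sup>2) =
     measure_pmf.expectation p (\<lambda>x. (f x - e)\<^sup>2 + (2 * (e - m) * (f x - e) + (e - m)\<^sup>2))"
    by (rule arg_cong[where f="measure_pmf.expectation p"]) (auto simp: power2_eq_square algebra_simps)
  also have "\<dots> = measure_pmf.expectation p (\<lambda>x. (f x - e)\<^sup>2) + (2 * (e - m) * (e - e) + (e - m)\<^sup>2)"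
    by (simp add: e_def[symmetric])
  finally show ?thesis by (simp add: e_def)
qed

text \<open>A weak form of the Efron-Stein inequality. When one coordinate is revealed, the variance
  becomes the mean conditional variance, bounded by induction, plus the variance of the conditional
  mean \<open>m\<close>. The latter varies by at most \<open>c\<close>, which costs
  \<open>c\<^sup>2\<close> per coordinate.\<close>

lemma variance_Pi_pmf_bounded_differences:
  fixes f :: "('a \<Rightarrow> 'b) \<Rightarrow> real"
  assumes "finite A" "\<And>x. x \<in> A \<Longrightarrow> finite (set_pmf (p x))"
    and "\<And>x g y z. x \<in> A \<Longrightarrow> \<bar>f (g(x := y)) - f (g(x := z))\<bar> \<le> c"
  shows "measure_pmf.expectation (Pi_pmf A d p)
    (\<lambda>g. (f g - measure_pmf.expectation (Pi_pmf A d p) f)\<^sup>2) \<le> real (card A) * c\<^sup>2"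
  using assms
proof (induction A arbitrary: f rule: finite_induct)
  case empty
  then show ?case by simp
next
  case (insert a A)
  let ?P = "Pi_pmf A d p"
  have finP: "finite (set_pmf ?P)" by (rule finite_set_pmf_Pi_pmf) (use insert in auto)
  have fina: "finite (set_pmf (p a))" using insert by auto
  note [simp] = integrable_measure_pmf_finite[OF finP] integrable_measure_pmf_finite[OF fina]
  have split: "measure_pmf.expectation (Pi_pmf (insert a A) d p) h =
     measure_pmf.expectation (p a) (\<lambda>y. measure_pmf.expectation ?P (\<lambda>g. h (g(a := y))))" for h :: "_ \<Rightarrow> real"
    unfolding Pi_pmf_insert'[OF insert(1,2)]
    by (simp add: expectation_bind_pmf_finite finP fina)
  define m where "m y = measure_pmf.expectation ?P (\<lambda>g. f (g(a := y)))" for y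
  define M where "M = measure_pmf.expectation (p a) m"
  have M: "measure_pmf.expectation (Pi_pmf (insert a A) d p) f = M"
    unfolding split M_def m_def ..
  have dm: "\<bar>m y - m z\<bar> \<le> c" for y z
  proof -
    have b: "f (g(a := y)) - f (g(a := z)) \<le> c" "- c \<le> f (g(a := y)) - f (g(a := z))" for g
      using insert.prems(2)[OF insertI1, of g y z] by linarith+
    have "m y - m z = measure_pmf.expectation ?P (\<lambda>g. f (g(a := y)) - f (g(a := z)))"
      by (simp add: m_def)
    moreover have "\<dots> \<le> c" by (rule expectation_le_const[OF finP]) (rule b(1))
    moreover have "- c \<le> measure_pmf.expectation ?P (\<lambda>g. f (g(a := y)) - f (g(a := z)))"
      by (rule expectation_ge_const[OF finP]) (rule b(2))
    ultimately show ?thesis by (simp add: abs_le_iff)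
  qed
  have mM: "(m y - M)\<^sup>2 \<le> c\<^sup>2" for y
  proof -
    have b: "m y - c \<le> m z" "m z \<le> m y + c" for z using dm[of y z] by linarith+
    have "m y - c \<le> M" unfolding M_def
      by (rule expectation_ge_const[OF fina]) (rule b(1))
    moreover have "M \<le> m y + c" unfolding M_def
      by (rule expectation_le_const[OF fina]) (rule b(2))
    ultimately have "\<bar>m y - M\<bar> \<le> c" by linarith
    then show ?thesis by (meson abs_ge_zero order_trans power2_le_iff_abs_le)
  qed
  have IH: "measure_pmf.expectation ?P (\<lambda>g. (f (g(a := y)) - m y)\<^sup>2) \<le> real (card A) * c\<^sup>2" for y
    unfolding m_def
  proof (rule insert.IH)
    fix x g y' z assume "x \<in> A"
    then have "x \<noteq> a" using insert by auto
    then have "(g(x := w))(a := y) = (g(a := y))(x := w)" for w by (simp add: fun_upd_twist)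
    then show "\<bar>f ((g(x := y'))(a := y)) - f ((g(x := z))(a := y))\<bar> \<le> c"
      using insert.prems(2)[OF insertI2[OF \<open>x \<in> A\<close>], of "g(a := y)" y' z] by (simp only:)
  qed (use insert in auto)
  have "measure_pmf.expectation ?P (\<lambda>g. (f (g(a := y)) - M)\<^sup>2) \<le> real (card A) * c\<^sup>2 + c\<^sup>2" for y
    using expectation_square_split[OF finP, of "\<lambda>g. f (g(a := y))" M] IH[of y] mM[of y]
    by (simp add: m_def)
  then have "measure_pmf.expectation (p a) (\<lambda>y. measure_pmf.expectation ?P (\<lambda>g. (f (g(a := y)) - M)\<^sup>2))
      \<le> real (card A) * c\<^sup>2 + c\<^sup>2"
    by (intro expectation_le_const[OF fina])
  then have "measure_pmf.expectation (Pi_pmf (insert a A) d p) (\<lambda>g. (f g - M)\<^sup>2) \<le> real (card (insert a A)) * c\<^sup>2"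
    using insert(1,2) unfolding split by (simp add: algebra_simps)
  then show ?case unfolding M .
qed

lemma chebyshev_finite:
  fixes f :: "'a \<Rightarrow> real"
  assumes "finite (set_pmf p)" "t > 0" "measure_pmf.expectation p (\<lambda>x. (f x - m)\<^sup>2) \<le> v"
  shows "measure_pmf.prob p {x. \<bar>f x - m\<bar> \<ge> t} \<le> v / t\<^sup>2"
proof -
  have "measure_pmf.prob p {x. \<bar>f x - m\<bar> \<ge> t} = measure_pmf.expectation p (indicat_real {x. \<bar>f x - m\<bar> \<ge> t})"
    by simp
  also have "\<dots> \<le> measure_pmf.expectation p (\<lambda>x. (f x - m)\<^sup>2 / t\<^sup>2)"
  proof (rule expectation_mono_finite[OF assms(1)])
    fix x
    have "t\<^sup>2 \<le> (f x - m)\<^sup>2" if "\<bar>f x - m\<bar> \<ge> t"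
      using that assms(2) by (metis abs_le_square_iff abs_of_pos)
    then show "indicat_real {x. \<bar>f x - m\<bar> \<ge> t} x \<le> (f x - m)\<^sup>2 / t\<^sup>2"
      using assms(2) by (auto simp: indicator_def)
  qed
  also have "\<dots> \<le> v / t\<^sup>2" using assms by (simp add: divide_right_mono)
  finally show ?thesis .
qed

section \<open>Simple symmetric random walk\<close>

primrec walk :: "nat \<Rightarrow> int pmf" where
  "walk 0 = return_pmf 0"
| "walk (Suc m) = do { s \<leftarrow> pmf_of_set {1, -1}; r \<leftarrow> walk m; return_pmf (s + r) }"

lemma finite_set_walk [simp]: "finite (set_pmf (walk m))"
  by (induction m) auto

lemma expectation_walk_Suc:
  fixes h :: "int \<Rightarrow> real"
  shows "measure_pmf.expectation (walk (Suc m)) h =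
   (measure_pmf.expectation (walk m) (\<lambda>r. h (1 + r)) + measure_pmf.expectation (walk m) (\<lambda>r. h (r - 1))) / 2"
  by (simp add: expectation_bind_pmf_finite integral_pmf_of_set)

lemma walk_moments:
  "measure_pmf.expectation (walk m) (\<lambda>r. (real_of_int r)\<^sup>2) = real m"
  "measure_pmf.expectation (walk m) (\<lambda>r. (real_of_int r) ^ 4) = 3 * (real m)\<^sup>2 - 2 * real m"
proof -
  note [simp] = integrable_measure_pmf_finite[OF finite_set_walk]
  show *: "measure_pmf.expectation (walk m) (\<lambda>r. (real_of_int r)\<^sup>2) = real m" for m
  proof (induction m)
    case (Suc m)
    have "measure_pmf.expectation (walk (Suc m)) (\<lambda>r. (real_of_int r)\<^sup>2) =
      measure_pmf.expectation (walk m) (\<lambda>r. ((1 + real_of_int r)\<^sup>2 + (real_of_int r - 1)\<^sup>2) / 2)"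
      unfolding expectation_walk_Suc by simp
    also have "\<dots> = measure_pmf.expectation (walk m) (\<lambda>r. (real_of_int r)\<^sup>2 + 1)"
      by (rule arg_cong[where f="measure_pmf.expectation _"]) (auto simp: power2_eq_square field_simps)
    finally show ?case using Suc by simp
  qed simp
  show "measure_pmf.expectation (walk m) (\<lambda>r. (real_of_int r) ^ 4) = 3 * (real m)\<^sup>2 - 2 * real m"
  proof (induction m)
    case (Suc m)
    have "measure_pmf.expectation (walk (Suc m)) (\<lambda>r. (real_of_int r) ^ 4) =
      measure_pmf.expectation (walk m) (\<lambda>r. ((1 + real_of_int r) ^ 4 + (real_of_int r - 1) ^ 4) / 2)"
      unfolding expectation_walk_Suc by simp
    also have "\<dots> = measure_pmf.expectation (walk m) (\<lambda>r. (real_of_int r) ^ 4 + (6 * (real_of_int r)\<^sup>2 + 1))"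
      by (rule arg_cong[where f="measure_pmf.expectation _"]) (auto simp: eval_nat_numeral field_simps)
    also have "\<dots> = 3 * (real m)\<^sup>2 - 2 * real m + (6 * real m + 1)"
      using Suc * by simp
    finally show ?case by (simp add: power2_eq_square algebra_simps)
  qed simp
qed

lemma walk_uminus: "map_pmf uminus (walk m) = walk m"
proof (induction m)
  case (Suc m)
  have u: "map_pmf uminus (pmf_of_set {1, -1 :: int}) = pmf_of_set {1, -1}"
    by (subst map_pmf_of_set_inj) (auto simp: insert_commute)
  have "map_pmf uminus (walk (Suc m)) =
     do { s \<leftarrow> map_pmf uminus (pmf_of_set {1, -1}); r \<leftarrow> map_pmf uminus (walk m); return_pmf (s + r) }"
    by (simp add: map_bind_pmf bind_map_pmf algebra_simps)
  then show ?case unfolding u Suc by simp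
qed simp

lemma prob_walk_uminus:
  "measure_pmf.prob (walk m) {r. - real_of_int r \<ge> t} = measure_pmf.prob (walk m) {r. real_of_int r \<ge> t}"
proof -
  have "measure_pmf.prob (walk m) {r. real_of_int r \<ge> t} = measure_pmf.prob (map_pmf uminus (walk m)) {r. real_of_int r \<ge> t}"
    by (simp only: walk_uminus)
  also have "\<dots> = measure_pmf.prob (walk m) {r. - real_of_int r \<ge> t}"
    by (simp add: vimage_def)
  finally show ?thesis ..
qed

text \<open>A Paley--Zygmund bound: with $z = r^2/m$ the indicator of $z \ge 1/4$ dominates
  $(z - 1/4)/2 - z^2/16$, whose mean only involves the second and the fourth moment.\<close>

lemma walk_anticoncentration:
  "measure_pmf.prob (walk m) {r. real_of_int r \<ge> sqrt (real m) / 2} \<ge> 3 / 32"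
proof (cases "m = 0")
  case False
  then have m: "real m > 0" by simp
  note [simp] = integrable_measure_pmf_finite[OF finite_set_walk]
  define h where "h r = (((real_of_int r)\<^sup>2 / real m - 1/4) / 2 - (real_of_int r) ^ 4 / (real m)\<^sup>2 / 16)" for r
  let ?A = "{r. real_of_int r \<ge> sqrt (real m) / 2}"
  let ?B = "{r. - real_of_int r \<ge> sqrt (real m) / 2}"
  have "3 / 16 \<le> ((1 - 1/4) / 2 - (3 * (real m)\<^sup>2 - 2 * real m) / (real m)\<^sup>2 / 16)"
    using m by (simp add: field_simps power2_eq_square)
  also have "\<dots> = measure_pmf.expectation (walk m) h"
    using m unfolding h_def by (simp add: walk_moments)
  also have "\<dots> \<le> measure_pmf.expectation (walk m) (\<lambda>r. indicat_real ?A r + indicat_real ?B r)"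
  proof (rule expectation_mono_finite)
    fix r
    define z where "z = (real_of_int r)\<^sup>2 / real m"
    have h: "h r = (z - 1/4) / 2 - z\<^sup>2 / 16"
      unfolding h_def z_def by (simp add: power_divide eval_nat_numeral)
    show "h r \<le> indicat_real ?A r + indicat_real ?B r"
    proof (cases "\<bar>real_of_int r\<bar> \<ge> sqrt (real m) / 2")
      case True
      then have "r \<in> ?A \<or> r \<in> ?B" by auto
      then have "indicat_real ?A r + indicat_real ?B r \<ge> 1" by (auto simp: indicator_def)
      moreover have "0 \<le> (1 - z / 4)\<^sup>2" by simp
      then have "h r \<le> 1" unfolding h by (simp add: power2_eq_square field_simps)
      ultimately show ?thesis by linarith
    next
      case False
      then have "\<bar>real_of_int r\<bar>\<^sup>2 \<le> (sqrt (real m) / 2)\<^sup>2" by (intro power_mono) auto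
      then have "z \<le> 1/4" unfolding z_def using m by (simp add: power_divide field_simps)
      moreover have "0 \<le> z\<^sup>2" by simp
      ultimately have "h r \<le> 0" unfolding h by (simp add: diff_le_eq add_increasing)
      then show ?thesis by (smt (verit) indicator_pos_le)
    qed
  qed simp
  also have "\<dots> = 2 * measure_pmf.prob (walk m) ?A"
    using prob_walk_uminus[of m "sqrt (real m) / 2"] by simp
  finally show ?thesis by simp
qed simp

lemma walk_add: "walk (m + k) = do { s \<leftarrow> walk m; r \<leftarrow> walk k; return_pmf (s + r) }"
proof (induction m)
  case (Suc m)
  then show ?case by (simp add: bind_assoc_pmf bind_return_pmf add.assoc)
qed (simp add: bind_return_pmf bind_return_pmf')

lemma expectation_walk_add:
  fixes h :: "int \<Rightarrow> real"
  shows "measure_pmf.expectation (walk (m + k)) h =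
    measure_pmf.expectation (walk m) (\<lambda>s. measure_pmf.expectation (walk k) (\<lambda>r. h (s + r)))"
  unfolding walk_add by (simp add: expectation_bind_pmf_finite)

text \<open>Each of \<open>J\<close> consecutive blocks of \<open>k\<close> steps independently
  rises by \<open>sqrt k / 2\<close> with probability at least 3/32. The total rise is
  \<open>sqrt J / 2\<close> standard deviations of the whole walk, so any fixed multiple of the
  standard deviation is exceeded with constant probability, without a central limit theorem.\<close>

lemma walk_block_anticoncentration:
  "measure_pmf.prob (walk (J * k)) {r. real_of_int r \<ge> real J * (sqrt (real k) / 2)} \<ge> (3 / 32) ^ J"
proof (induction J)
  case (Suc J)
  let ?s = "sqrt (real k) / 2"
  let ?A = "{r. real_of_int r \<ge> ?s}" and ?B = "{r. real_of_int r \<ge> real J * ?s}"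
  note [simp] = integrable_measure_pmf_finite[OF finite_set_walk]
  have "(3 / 32) ^ Suc J \<le> measure_pmf.prob (walk k) ?A * measure_pmf.prob (walk (J * k)) ?B"
    using mult_mono[OF walk_anticoncentration[of k] Suc] by simp
  also have "\<dots> = measure_pmf.expectation (walk k) (\<lambda>s. measure_pmf.expectation (walk (J * k)) (\<lambda>r. indicat_real ?A s * indicat_real ?B r))"
    by simp
  also have "\<dots> \<le> measure_pmf.expectation (walk k) (\<lambda>s. measure_pmf.expectation (walk (J * k))
       (\<lambda>r. indicat_real {r. real_of_int r \<ge> real (Suc J) * ?s} (s + r)))"
    by (intro expectation_mono_finite) (auto simp: indicator_def algebra_simps)
  also have "\<dots> = measure_pmf.expectation (walk (k + J * k)) (indicat_real {r. real_of_int r \<ge> real (Suc J) * ?s})"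
    by (rule expectation_walk_add[symmetric])
  finally show ?case by simp
qed simp

section \<open>Counting triples of messages\<close>

lemma card_subsets_by_part_cards:
  assumes "finite X" "Y \<subseteq> X"
  shows "card {S. S \<subseteq> X \<and> card (S \<inter> Y) = a \<and> card (S - Y) = b} = (card Y choose a) * (card (X - Y) choose b)"
proof -
  have fY: "finite Y" "finite (X - Y)" using assms finite_subset by auto
  let ?L = "{S. S \<subseteq> X \<and> card (S \<inter> Y) = a \<and> card (S - Y) = b}"
  let ?R = "{T. T \<subseteq> Y \<and> card T = a} \<times> {T. T \<subseteq> X - Y \<and> card T = b}"
  have "bij_betw (\<lambda>S. (S \<inter> Y, S - Y)) ?L ?R"
  proof (rule bij_betw_byWitness[where f' = "\<lambda>(T, U). T \<union> U"])
    show "(\<lambda>(T, U). T \<union> U) ` ?R \<subseteq> ?L"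
    proof safe
      fix T U x assume "T \<subseteq> Y" "U \<subseteq> X - Y"
      then have "(T \<union> U) \<inter> Y = T" "T \<union> U - Y = U" by auto
      then show "card ((T \<union> U) \<inter> Y) = card T" "card (T \<union> U - Y) = card U" by simp_all
    qed (use assms in auto)
  qed (use assms in auto)
  then have "card ?L = card ?R" by (rule bij_betw_same_card)
  then show ?thesis by (simp add: card_cartesian_product n_subsets fY)
qed

text \<open>Counts the 3-subsets of \<open>i + j\<close> objects with at least two among the
  \<open>i\<close>: all three of them, or two of them and one of the \<open>j\<close>.\<close>

definition majority_triples :: "nat \<Rightarrow> nat \<Rightarrow> nat" where
  "majority_triples i j = (i choose 3) + (i choose 2) * j"

lemma card_majority_triples:
  assumes "finite X" "Y \<subseteq> X"
  shows "card {S. S \<subseteq> X \<and> card S = 3 \<and> card (S \<inter> Y) \<ge> 2} = majority_triples (card Y) (card (X - Y))"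
proof -
  let ?A = "\<lambda>a b. {S. S \<subseteq> X \<and> card (S \<inter> Y) = a \<and> card (S - Y) = b}"
  have fin: "finite (?A a b)" for a b using assms by simp
  have c: "card S = card (S \<inter> Y) + card (S - Y)" if "S \<subseteq> X" for S
    using that assms by (metis card_Int_Diff finite_subset)
  have "{S. S \<subseteq> X \<and> card S = 3 \<and> card (S \<inter> Y) \<ge> 2} = ?A 3 0 \<union> ?A 2 1"
    using c by auto
  moreover have "?A 3 0 \<inter> ?A 2 1 = {}" by auto
  ultimately have "card {S. S \<subseteq> X \<and> card S = 3 \<and> card (S \<inter> Y) \<ge> 2} = card (?A 3 0) + card (?A 2 1)"
    using card_Un_disjoint[OF fin fin] by simp
  then show ?thesis
    by (simp add: card_subsets_by_part_cards[OF assms] majority_triples_def)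
qed

lemma sum_Pow_card:
  fixes f :: "nat \<Rightarrow> real"
  assumes "finite X"
  shows "(\<Sum>S\<in>Pow X. f (card S)) = (\<Sum>k\<le>card X. real (card X choose k) * f k)"
proof -
  have "(\<Sum>S\<in>Pow X. f (card S)) = (\<Sum>k\<le>card X. \<Sum>S\<in>{S\<in>Pow X. card S = k}. f (card S))"
    using assms by (intro sum.group[symmetric]) (auto intro: card_mono)
  also have "\<dots> = (\<Sum>k\<le>card X. real (card X choose k) * f k)"
    using n_subsets[OF assms] by (intro sum.cong refl) simp
  finally show ?thesis .
qed

text \<open>Writing \<open>S\<close> as \<open>T\<close> plus a subset of the rest shows that the
  value is the same for all triples \<open>T\<close>. This is the exchangeability of messages in its
  combinatorial form.\<close>

lemma sum_supersets_card:
  fixes f :: "nat \<Rightarrow> real"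
  assumes "finite X" "T \<subseteq> X" "card T = 3"
  shows "(\<Sum>S\<in>{S\<in>Pow X. T \<subseteq> S}. f (card S)) = (\<Sum>k\<le>card X - 3. real ((card X - 3) choose k) * f (k + 3))"
proof -
  have fT: "finite T" using assms finite_subset by auto
  have "(\<Sum>S\<in>{S\<in>Pow X. T \<subseteq> S}. f (card S)) = (\<Sum>U\<in>Pow (X - T). f (card U + 3))"
  proof (rule sum.reindex_bij_witness[where i = "\<lambda>U. U \<union> T" and j = "\<lambda>S. S - T"])
    fix S assume S: "S \<in> {S\<in>Pow X. T \<subseteq> S}"
    then have "finite S" using assms finite_subset by auto
    then show "f (card (S - T) + 3) = f (card S)"
      using S assms fT card_mono[of S T] by (simp add: card_Diff_subset)
  qed (use assms in auto)
  also have "\<dots> = (\<Sum>k\<le>card (X - T). real (card (X - T) choose k) * f (k + 3))"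
    using assms by (intro sum_Pow_card) auto
  also have "card (X - T) = card X - 3" using assms fT by (simp add: card_Diff_subset)
  finally show ?thesis .
qed

text \<open>The weight of each triple of messages depends only on the numbers of messages, so the triple
  used by a node with at least three messages is uniformly distributed.\<close>

lemma uniform_triple:
  fixes w :: "nat \<Rightarrow> real"
  assumes "finite X" "card X \<ge> 3" "\<And>T. T \<in> F \<Longrightarrow> T \<subseteq> X \<and> card T = 3"
  shows "(\<Sum>S\<in>{S\<in>Pow X. card S \<ge> 3}. w (card S) * (real (card {T\<in>F. T \<subseteq> S}) / real (card S choose 3))) =
    real (card F) / real (card X choose 3) * (\<Sum>S\<in>{S\<in>Pow X. card S \<ge> 3}. w (card S))"
proof -
  define r where "r = (\<Sum>k\<le>card X - 3. real ((card X - 3) choose k) * (w (k + 3) / real ((k + 3) choose 3)))"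
  have *: "(\<Sum>S\<in>{S\<in>Pow X. card S \<ge> 3}. w (card S) * (real (card {T\<in>G. T \<subseteq> S}) / real (card S choose 3))) = real (card G) * r"
    if G: "\<And>T. T \<in> G \<Longrightarrow> T \<subseteq> X \<and> card T = 3" for G
  proof -
    have fG: "finite G" using G assms(1) by (intro finite_subset[of G "Pow X"]) auto
    have "(\<Sum>S\<in>{S\<in>Pow X. card S \<ge> 3}. w (card S) * (real (card {T\<in>G. T \<subseteq> S}) / real (card S choose 3))) =
      (\<Sum>S\<in>{S\<in>Pow X. card S \<ge> 3}. \<Sum>T\<in>{T\<in>G. T \<subseteq> S}. w (card S) / real (card S choose 3))"
      by (simp add: mult.commute)
    also have "\<dots> = (\<Sum>T\<in>G. \<Sum>S\<in>{S\<in>{S\<in>Pow X. card S \<ge> 3}. T \<subseteq> S}. w (card S) / real (card S choose 3))"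
      by (rule sum.swap_restrict) (use assms fG in auto)
    also have "\<dots> = (\<Sum>T\<in>G. r)"
    proof (rule sum.cong[OF refl])
      fix T assume T: "T \<in> G"
      have "card S \<ge> 3" if "S \<subseteq> X" "T \<subseteq> S" for S
        using card_mono[of S T] G[OF T] finite_subset[OF that(1) assms(1)] that by simp
      then have "{S\<in>{S\<in>Pow X. card S \<ge> 3}. T \<subseteq> S} = {S\<in>Pow X. T \<subseteq> S}"
        by blast
      then show "(\<Sum>S\<in>{S\<in>{S\<in>Pow X. card S \<ge> 3}. T \<subseteq> S}. w (card S) / real (card S choose 3)) = r"
        using sum_supersets_card[OF assms(1), of T "\<lambda>k. w k / real (k choose 3)"] G[OF T] by (simp add: r_def)
    qed
    finally show ?thesis by simp
  qed
  have "(\<Sum>S\<in>{S\<in>Pow X. card S \<ge> 3}. w (card S)) =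
     (\<Sum>S\<in>{S\<in>Pow X. card S \<ge> 3}. w (card S) * (real (card {T\<in>{T. T \<subseteq> X \<and> card T = 3}. T \<subseteq> S}) / real (card S choose 3)))"
  proof (rule sum.cong[OF refl])
    fix S assume S: "S \<in> {S\<in>Pow X. card S \<ge> 3}"
    then have "{T\<in>{T. T \<subseteq> X \<and> card T = 3}. T \<subseteq> S} = {T. T \<subseteq> S \<and> card T = 3}" by auto
    moreover have "finite S" using S assms(1) finite_subset by auto
    ultimately have "card {T\<in>{T. T \<subseteq> X \<and> card T = 3}. T \<subseteq> S} = card S choose 3" by (simp add: n_subsets)
    moreover have "card S choose 3 > 0" using S by (simp add: zero_less_binomial)
    ultimately show "w (card S) = w (card S) * (real (card {T\<in>{T. T \<subseteq> X \<and> card T = 3}. T \<subseteq> S}) / real (card S choose 3))"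
      by simp
  qed
  also have "\<dots> = real (card X choose 3) * r"
    by (subst *) (auto simp: n_subsets assms(1))
  finally have r: "(\<Sum>S\<in>{S\<in>Pow X. card S \<ge> 3}. w (card S)) = real (card X choose 3) * r" .
  have "real (card X choose 3) > 0" using assms(2) by (simp add: zero_less_binomial)
  then show ?thesis unfolding r using *[of F] assms(3) by simp
qed

lemma real_choose_2: "real (k choose 2) = real k * (real k - 1) / 2"
  by (induction k) (auto simp: numeral_2_eq_2 field_simps)

lemma real_choose_3: "real (k choose 3) = real k * (real k - 1) * (real k - 2) / 6"
proof (induction k)
  case (Suc k)
  have "Suc k choose 3 = (k choose 3) + (k choose 2)" by (simp add: eval_nat_numeral)
  then show ?case using Suc real_choose_2[of k] by (simp add: field_simps)
qed simp

text \<open>Three draws with replacement from values of bias \<beta> have a majority of bias exactly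
  \<beta>(3 - \<beta>^2)/2. Drawing without replacement only helps the larger side: in terms of the
  sum m and the difference d, the correction (m^2 - d^2)/2 is divided by (m - 1)(m - 2) instead of
  m^2.\<close>

lemma majority_triples_difference:
  assumes "i \<ge> j" "i + j \<ge> 3"
  defines "\<beta> \<equiv> (real i - real j) / (real i + real j)"
  shows "(real (majority_triples i j) - real (majority_triples j i)) / real ((i + j) choose 3) \<ge> \<beta> * (3 - \<beta>\<^sup>2) / 2"
proof -
  define m where "m = real i + real j"
  define d where "d = real i - real j"
  have m: "m \<ge> 3" and d: "d \<ge> 0" unfolding m_def d_def using assms by auto
  have ij: "real i = (m + d) / 2" "real j = (m - d) / 2" unfolding m_def d_def by simp_all
  have den: "real ((i + j) choose 3) = m * (m - 1) * (m - 2) / 6"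
    by (simp add: real_choose_3 m_def)
  have num: "real (majority_triples i j) - real (majority_triples j i) = d * ((m - 1) * (m - 2) + (m\<^sup>2 - d\<^sup>2) / 2) / 6"
    unfolding majority_triples_def of_nat_add of_nat_mult real_choose_2 real_choose_3 ij
    by (simp add: field_simps power2_eq_square)
  have dm: "d \<le> m" unfolding d_def m_def by simp
  have P: "(m - 1) * (m - 2) > 0" using m by (intro mult_pos_pos) auto
  have "\<beta> * (3 - \<beta>\<^sup>2) / 2 = d / m * (1 + ((m\<^sup>2 - d\<^sup>2) / 2) / m\<^sup>2)"
    using m unfolding \<beta>_def d_def[symmetric] m_def[symmetric] by (simp add: field_simps power2_eq_square)
  also have "\<dots> \<le> d / m * (1 + ((m\<^sup>2 - d\<^sup>2) / 2) / ((m - 1) * (m - 2)))"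
  proof (intro mult_left_mono add_left_mono divide_left_mono)
    show "(m - 1) * (m - 2) \<le> m\<^sup>2" using m by (simp add: algebra_simps power2_eq_square)
    show "0 \<le> (m\<^sup>2 - d\<^sup>2) / 2" using d dm by (simp add: power_mono)
    show "0 < m\<^sup>2 * ((m - 1) * (m - 2))" using m P by simp
  qed (use d m in auto)
  also have "\<dots> = d * ((m - 1) * (m - 2) + (m\<^sup>2 - d\<^sup>2) / 2) / 6 / (m * (m - 1) * (m - 2) / 6)"
    using m P by (simp add: divide_simps)
  finally show ?thesis unfolding num den .
qed

section \<open>One round on the level of values\<close>

text \<open>Undefined nodes draw targets as well, and \<open>deliver\<close> discards them. Hence
  this distribution does not depend on the values.\<close>

definition targets :: "nat \<Rightarrow> (nat \<Rightarrow> nat \<Rightarrow> nat) pmf" where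
  "targets n = Pi_pmf {..<n} (\<lambda>_. 0) (\<lambda>_. Pi_pmf {..<6} 0 (\<lambda>_. pmf_of_set {..<n}))"

definition updates :: "nat \<Rightarrow> nat set \<Rightarrow> (nat \<Rightarrow> bool option) \<Rightarrow> (nat \<Rightarrow> nat \<Rightarrow> nat) \<Rightarrow> (nat \<Rightarrow> bool option) pmf" where
  "updates n B x tgt = Pi_pmf {..<n} None (\<lambda>v. node_update 3 False (v \<in> B) (x v) (deliver n 6 x tgt v))"

text \<open>One step of the chain of value vectors straddles two rounds: the targets drawn at the
  end of a round, followed by the updates at the start of the next one, with that next round's
  blocked set \<open>B\<close>.\<close>

definition step :: "nat \<Rightarrow> nat set \<Rightarrow> (nat \<Rightarrow> bool option) \<Rightarrow> (nat \<Rightarrow> bool option) pmf" where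
  "step n B x = targets n \<bind> updates n B x"

definition msgs :: "nat \<Rightarrow> (nat \<Rightarrow> bool option) \<Rightarrow> bool \<Rightarrow> (nat \<times> nat) set" where
  "msgs n x b = {u. u < n \<and> x u = Some b} \<times> {..<6}"

text \<open>A message is identified by its sender and its slot, so messages with equal values stay
  distinct. The inbox list of \<open>deliver\<close> forgets this identity, which the
  exchangeability argument needs.\<close>

definition received :: "nat \<Rightarrow> (nat \<Rightarrow> bool option) \<Rightarrow> nat \<Rightarrow> (nat \<Rightarrow> nat \<Rightarrow> nat) \<Rightarrow> (nat \<times> nat) set" where
  "received n x v tgt = {(u, j) \<in> msgs n x True \<union> msgs n x False. tgt u j = v}"

lemma finite_msgs [simp]: "finite (msgs n x b)"
  by (simp add: msgs_def)

lemma msgs_disjoint: "msgs n x b \<inter> msgs n x (\<not> b) = {}"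
  by (auto simp: msgs_def)

lemma card_msgs: "card (msgs n x b) = 6 * card {u\<in>{..<n}. x u = Some b}"
  by (simp add: msgs_def card_cartesian_product)

lemma set_pmf_of_lessThan: "n > 0 \<Longrightarrow> set_pmf (pmf_of_set {..<n}) = {..<n::nat}"
  by (subst set_pmf_of_set) auto

lemma finite_set_targets: "n > 0 \<Longrightarrow> finite (set_pmf (targets n))"
  unfolding targets_def by (intro finite_set_pmf_Pi_pmf) (auto simp: set_pmf_of_lessThan)

lemma finite_set_node_update: "finite (set_pmf (node_update l first blocked xu inb))"
proof -
  have "set_pmf (node_update l first blocked xu inb) \<subseteq> {None, xu} \<union> {Some True, Some False}"
    unfolding node_update_def by (auto simp: set_map_pmf)
  then show ?thesis by (rule finite_subset) auto
qed

lemma finite_set_updates: "finite (set_pmf (updates n B x tgt))"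
  unfolding updates_def by (intro finite_set_pmf_Pi_pmf finite_set_node_update) auto

lemma finite_set_step: "n > 0 \<Longrightarrow> finite (set_pmf (step n B x))"
  unfolding step_def by (auto simp: finite_set_targets finite_set_updates)

lemma expectation_step:
  fixes f :: "(nat \<Rightarrow> bool option) \<Rightarrow> real"
  assumes "n > 0"
  shows "measure_pmf.expectation (step n B x) f =
    measure_pmf.expectation (targets n) (\<lambda>tgt. measure_pmf.expectation (updates n B x tgt) f)"
  unfolding step_def
  by (rule expectation_bind_pmf_finite) (auto simp: assms finite_set_targets finite_set_updates)

lemma count_list_concat: "count_list (concat xss) b = sum_list (map (\<lambda>xs. count_list xs b) xss)"
  by (induction xss) auto

lemma count_list_replicate: "count_list (replicate m a) b = (if a = b then m else 0)"
  by (induction m) auto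

lemma count_deliver:
  assumes "v < n"
  shows "count_list (deliver n 6 x tgt v) b = card (received n x v tgt \<inter> msgs n x b)"
proof -
  have "count_list (deliver n 6 x tgt v) b = (\<Sum>u<n. if x u = Some b then card {j\<in>{..<6}. tgt u j = v} else 0)"
    using assms unfolding deliver_def
    by (auto simp: count_list_concat comp_def interv_sum_list_conv_sum_set_nat count_list_replicate
        atLeast0LessThan intro!: sum.cong split: option.split)
  also have "\<dots> = (\<Sum>u\<in>{u\<in>{..<n}. x u = Some b}. card {j\<in>{..<6}. tgt u j = v})"
    by (rule sum.inter_filter[symmetric]) simp
  also have "\<dots> = card (SIGMA u:{u\<in>{..<n}. x u = Some b}. {j\<in>{..<6}. tgt u j = v})"
    by (subst card_SigmaI) auto
  also have "(SIGMA u:{u\<in>{..<n}. x u = Some b}. {j\<in>{..<6}. tgt u j = v}) = received n x v tgt \<inter> msgs n x b"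
    by (cases b) (auto simp: received_def msgs_def)
  finally show ?thesis .
qed

lemma length_count_bool: "length (xs :: bool list) = count_list xs b + count_list xs (\<not> b)"
  by (induction xs) auto

lemma card_received: "card (received n x v tgt) = card (received n x v tgt \<inter> msgs n x b) + card (received n x v tgt \<inter> msgs n x (\<not> b))"
proof -
  have "received n x v tgt = received n x v tgt \<inter> msgs n x b \<union> received n x v tgt \<inter> msgs n x (\<not> b)"
    by (cases b) (auto simp: received_def)
  moreover have "card (received n x v tgt \<inter> msgs n x b \<union> received n x v tgt \<inter> msgs n x (\<not> b)) =
      card (received n x v tgt \<inter> msgs n x b) + card (received n x v tgt \<inter> msgs n x (\<not> b))"
    by (rule card_Un_disjoint) (use msgs_disjoint[of n x b] in auto)
  ultimately show ?thesis by simp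
qed

lemma length_deliver: "v < n \<Longrightarrow> length (deliver n 6 x tgt v) = card (received n x v tgt)"
  using length_count_bool[of "deliver n 6 x tgt v" True] card_received[of n x v tgt True] by (simp add: count_deliver)

lemma card_index_count: "card {k. k < length xs \<and> xs ! k = b} = count_list xs b"
  by (simp add: count_list_eq_length_filter length_filter_conv_card eq_commute)

lemma prob_node_update:
  assumes "length inb \<ge> 3"
  shows "measure_pmf.prob (node_update 3 False False xu inb) {Some b} =
    real (majority_triples (count_list inb b) (count_list inb (\<not> b))) / real (length inb choose 3)"
proof -
  let ?X = "{..<length inb}" and ?Y = "{k. k < length inb \<and> inb ! k = b}"
  let ?F = "{S. S \<subseteq> ?X \<and> card S = 3}"
  have F: "card ?F = length inb choose 3" by (simp add: n_subsets)
  have pos: "length inb choose 3 > 0" using assms by (simp add: zero_less_binomial)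
  have ne: "finite ?F" "?F \<noteq> {}" using F pos by (simp, intro notI, simp)
  have maj: "majority_of inb S = b \<longleftrightarrow> card (S \<inter> ?Y) \<ge> 2" if "S \<in> ?F" for S
  proof -
    have fS: "finite S" using that finite_subset by blast
    have c: "card S = card {i\<in>S. inb ! i} + card {i\<in>S. \<not> inb ! i}"
      by (subst card_Un_disjoint[symmetric]) (use fS in \<open>auto intro: arg_cong[where f=card]\<close>)
    have "S \<inter> ?Y = (if b then {i\<in>S. inb ! i} else {i\<in>S. \<not> inb ! i})" using that by auto
    then show ?thesis using c that unfolding majority_of_def by (cases b) auto
  qed
  have "measure_pmf.prob (node_update 3 False False xu inb) {Some b} =
     measure_pmf.prob (pmf_of_set ?F) ((\<lambda>S. Some (majority_of inb S)) -` {Some b})"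
    using assms unfolding node_update_def by simp
  also have "\<dots> = real (card (?F \<inter> {S. majority_of inb S = b})) / real (card ?F)"
    using ne by (subst measure_pmf_of_set) (auto simp: vimage_def)
  also have "?F \<inter> {S. majority_of inb S = b} = {S. S \<subseteq> ?X \<and> card S = 3 \<and> card (S \<inter> ?Y) \<ge> 2}"
    using maj by auto
  also have "card \<dots> = majority_triples (card ?Y) (card (?X - ?Y))"
    by (rule card_majority_triples) auto
  also have "?X - ?Y = {k. k < length inb \<and> inb ! k = (\<not> b)}" by auto
  finally show ?thesis unfolding F card_index_count .
qed

text \<open>Choosing three of four messages means omitting one, and the majority is then the
  opposite of the omitted value. Each value is omitted by two of the four choices, so the update is
  a fair coin.\<close>

lemma node_update_two_two:
  assumes "count_list inb True = 2" "count_list inb False = 2"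
  shows "node_update 3 False False xu inb = pmf_of_set {Some True, Some False}"
proof -
  have len: "length inb = 4" using length_count_bool[of inb True] assms by simp
  have h: "pmf (node_update 3 False False xu inb) (Some b) = 1/2" for b
    using prob_node_update[of inb xu b] len assms
    by (cases b) (simp_all add: measure_pmf_single majority_triples_def eval_nat_numeral)
  have N: "pmf (node_update 3 False False xu inb) None = 0"
    using len by (auto simp: pmf_eq_0_set_pmf node_update_def)
  show ?thesis
  proof (rule pmf_eqI)
    fix y show "pmf (node_update 3 False False xu inb) y = pmf (pmf_of_set {Some True, Some False}) y"
      by (cases y) (auto simp: h N indicator_def)
  qed
qed

text \<open>The event is a conjunction of conditions on single targets, which are independent:
  messages in \<open>S\<close> hit \<open>v\<close> and the other messages that are sent miss
  it.\<close>

lemma prob_received: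
  assumes n: "n > 0" and v: "v < n" and S: "S \<subseteq> msgs n x True \<union> msgs n x False"
  defines "M \<equiv> card (msgs n x True \<union> msgs n x False)"
  shows "measure_pmf.prob (targets n) {tgt. received n x v tgt = S} = (1 / real n) ^ card S * (1 - 1 / real n) ^ (M - card S)"
proof -
  let ?P = "msgs n x True \<union> msgs n x False"
  \<comment> \<open>The admissible targets of each slot; slots of undefined nodes carry no message
    and are left unconstrained.\<close>
  define X where "X u j = (if (u, j) \<in> S then {v} else if (u, j) \<in> ?P then - {v} else UNIV)" for u j
  have fS: "finite S" using S by (rule finite_subset) simp
  have u: "measure_pmf.prob (pmf_of_set {..<n}) (X u j) =
     (if (u, j) \<in> S then 1 / real n else 1) * (if (u, j) \<in> ?P - S then 1 - 1 / real n else 1)" for u j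
  proof -
    have a: "measure_pmf.prob (pmf_of_set {..<n}) {v} = 1 / real n"
      using n v by (subst measure_pmf_of_set) auto
    then have "measure_pmf.prob (pmf_of_set {..<n}) (- {v}) = 1 - 1 / real n"
      using measure_pmf.prob_compl[of "{v}" "pmf_of_set {..<n}"] by (simp add: Compl_eq_Diff_UNIV)
    then show ?thesis using a by (auto simp: X_def)
  qed
  have "{tgt. received n x v tgt = S} = Pi {..<n} (\<lambda>u. Pi {..<6} (X u))"
  proof (intro set_eqI iffI)
    fix tgt assume "tgt \<in> {tgt. received n x v tgt = S}"
    then show "tgt \<in> Pi {..<n} (\<lambda>u. Pi {..<6} (X u))"
      by (auto simp: X_def received_def)
  next
    fix tgt assume *: "tgt \<in> Pi {..<n} (\<lambda>u. Pi {..<6} (X u))"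
    have "tgt u j \<in> X u j" if "(u, j) \<in> ?P" for u j
    proof -
      have "u < n" "j < 6" using that by (auto simp: msgs_def)
      then show ?thesis using * by auto
    qed
    then have "(u, j) \<in> received n x v tgt \<longleftrightarrow> (u, j) \<in> S" for u j
      using S unfolding received_def X_def by (cases "(u, j) \<in> ?P"; cases "(u, j) \<in> S") force+
    then show "tgt \<in> {tgt. received n x v tgt = S}" by auto
  qed
  then have "measure_pmf.prob (targets n) {tgt. received n x v tgt = S} =
     (\<Prod>u<n. \<Prod>j<6. measure_pmf.prob (pmf_of_set {..<n}) (X u j))"
    unfolding targets_def by (simp add: measure_Pi_pmf_Pi)
  also have "\<dots> = (\<Prod>e\<in>{..<n} \<times> {..<6}. (if e \<in> S then 1 / real n else 1) * (if e \<in> ?P - S then 1 - 1 / real n else 1))"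
    unfolding u prod.cartesian_product by (intro prod.cong) auto
  also have "\<dots> = (\<Prod>e\<in>S. 1 / real n) * (\<Prod>e\<in>?P - S. 1 - 1 / real n)"
  proof -
    have "(\<Prod>e\<in>{..<n} \<times> {..<6}. if e \<in> Q then c else 1) = (\<Prod>e\<in>Q. c)"
      if "Q \<subseteq> ?P" for Q and c :: real
    proof -
      have "({..<n} \<times> {..<6}) \<inter> Q = Q" using that by (auto simp: msgs_def)
      then show ?thesis using prod.inter_restrict[of "{..<n} \<times> {..<6}" "\<lambda>_. c" Q] by simp
    qed
    then show ?thesis using S unfolding prod.distrib by (metis Diff_subset)
  qed
  also have "\<dots> = (1 / real n) ^ card S * (1 - 1 / real n) ^ (M - card S)"
    using S fS by (simp add: M_def card_Diff_subset)
  finally show ?thesis .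
qed

lemma expectation_received:
  fixes x :: "nat \<Rightarrow> bool option" and f :: "(nat \<times> nat) set \<Rightarrow> real"
  assumes "n > 0" and "v < n"
  defines "P \<equiv> msgs n x True \<union> msgs n x False"
  shows "measure_pmf.expectation (targets n) (\<lambda>tgt. f (received n x v tgt)) =
    (\<Sum>S\<in>Pow P. f S * ((1 / real n) ^ card S * (1 - 1 / real n) ^ (card P - card S)))"
proof -
  have "measure_pmf.expectation (targets n) (\<lambda>tgt. f (received n x v tgt)) =
    measure_pmf.expectation (map_pmf (received n x v) (targets n)) f" by simp
  also have "\<dots> = (\<Sum>S\<in>Pow P. f S * pmf (map_pmf (received n x v) (targets n)) S)"
    by (rule integral_measure_pmf_real) (auto simp: P_def received_def)
  also have "\<dots> = (\<Sum>S\<in>Pow P. f S * ((1 / real n) ^ card S * (1 - 1 / real n) ^ (card P - card S)))"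
  proof (intro sum.cong refl arg_cong2[where f="(*)"])
    fix S assume "S \<in> Pow P"
    then show "pmf (map_pmf (received n x v) (targets n)) S = (1 / real n) ^ card S * (1 - 1 / real n) ^ (card P - card S)"
      using prob_received[OF assms(1,2), of S x] by (simp add: pmf_map vimage_def P_def)
  qed
  finally show ?thesis .
qed

section \<open>Mean and variance of a round\<close>

text \<open>Both the number of defined nodes and the signed gap have this additive form, so one mean
  formula and one variance bound serve for both.\<close>

definition stat :: "nat \<Rightarrow> (bool option \<Rightarrow> real) \<Rightarrow> (nat \<Rightarrow> bool option) \<Rightarrow> real" where
  "stat n g x = (\<Sum>v<n. g (x v))"

definition node_mean :: "(bool option \<Rightarrow> real) \<Rightarrow> bool \<Rightarrow> bool list \<Rightarrow> real" where
  "node_mean g blocked inb = measure_pmf.expectation (node_update 3 False blocked None inb) g"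

lemma node_mean_eq: "measure_pmf.expectation (node_update 3 False blocked xu inb) g = node_mean g blocked inb"
  by (simp add: node_mean_def node_update_def)

lemma abs_node_mean:
  assumes "\<And>y. \<bar>g y\<bar> \<le> 1"
  shows "\<bar>node_mean g blocked inb\<bar> \<le> 1"
proof -
  have "node_mean g blocked inb \<le> 1" unfolding node_mean_def
    by (rule expectation_le_const[OF finite_set_node_update]) (use assms abs_le_D1 in blast)
  moreover have "- 1 \<le> node_mean g blocked inb" unfolding node_mean_def
    by (rule expectation_ge_const[OF finite_set_node_update]) (use assms abs_le_D2 minus_le_iff in blast)
  ultimately show ?thesis by linarith
qed

lemma expectation_updates_stat:
  "measure_pmf.expectation (updates n B x tgt) (stat n g) = (\<Sum>v<n. node_mean g (v \<in> B) (deliver n 6 x tgt v))"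
proof -
  have "measure_pmf.expectation (updates n B x tgt) (stat n g) =
    (\<Sum>v<n. measure_pmf.expectation (updates n B x tgt) (\<lambda>f. g (f v)))"
    unfolding stat_def by (subst Bochner_Integration.integral_sum)
      (auto intro: integrable_measure_pmf_finite finite_set_updates)
  then show ?thesis unfolding updates_def by (simp add: expectation_Pi_pmf_component node_mean_eq)
qed

lemma deliver_update_cong:
  assumes "v \<notin> y ` {..<6}" "v \<notin> z ` {..<6}"
  shows "deliver n 6 x (t(u := y)) v = deliver n 6 x (t(u := z)) v"
proof -
  have "{j\<in>{..<6}. (t(u := y)) w j = v} = {j\<in>{..<6}. (t(u := z)) w j = v}" for w
    using assms by auto
  then show ?thesis unfolding deliver_def by (simp cong: option.case_cong)
qed

text \<open>Redirecting the six messages of one sender affects at most the six old and the six new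
  receivers, and each conditional mean moves by at most 2.\<close>

lemma expectation_updates_stat_bounded_differences:
  assumes "\<And>y. \<bar>g y\<bar> \<le> 1"
  shows "\<bar>measure_pmf.expectation (updates n B x (t(u := y))) (stat n g) -
    measure_pmf.expectation (updates n B x (t(u := z))) (stat n g)\<bar> \<le> 24"
proof -
  let ?a = "\<lambda>v. node_mean g (v \<in> B) (deliver n 6 x (t(u := y)) v)"
  let ?b = "\<lambda>v. node_mean g (v \<in> B) (deliver n 6 x (t(u := z)) v)"
  let ?Q = "y ` {..<6} \<union> z ` {..<6}"
  have cQ: "card ?Q \<le> 12"
    using card_Un_le[of "y ` {..<6}" "z ` {..<6}"] card_image_le[of "{..<6}" y] card_image_le[of "{..<6}" z] by simp
  have "\<bar>(\<Sum>v<n. ?a v) - (\<Sum>v<n. ?b v)\<bar> \<le> (\<Sum>v<n. \<bar>?a v - ?b v\<bar>)"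
    unfolding sum_subtractf[symmetric] by (rule sum_abs)
  also have "\<dots> \<le> (\<Sum>v<n. if v \<in> ?Q then 2 else 0)"
  proof (rule sum_mono)
    fix v
    show "\<bar>?a v - ?b v\<bar> \<le> (if v \<in> ?Q then 2 else 0)"
      using abs_node_mean[of g "v \<in> B" "deliver n 6 x (t(u := y)) v", OF assms]
        abs_node_mean[of g "v \<in> B" "deliver n 6 x (t(u := z)) v", OF assms]
        deliver_update_cong[of v y z n x t u] by (auto simp del: fun_upd_apply)
  qed
  also have "\<dots> = 2 * real (card ({..<n} \<inter> ?Q))"
    by (simp add: sum.If_cases Collect_disj_eq)
  also have "card ({..<n} \<inter> ?Q) \<le> card ?Q" by (rule card_mono) auto
  then have "2 * real (card ({..<n} \<inter> ?Q)) \<le> 24" using cQ by simp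
  finally show ?thesis unfolding expectation_updates_stat .
qed

text \<open>Given the targets, the nodes update independently and each moves the sum by at most 2,
  which contributes \<open>4 * n\<close>. The conditional mean, as a function of \<open>n\<close>
  independent target vectors, contributes \<open>24\<^sup>2 * n\<close>; together 580 n.\<close>

lemma variance_step_stat:
  assumes n: "n > 0" and g: "\<And>y. \<bar>g y\<bar> \<le> 1"
  shows "measure_pmf.expectation (step n B x) (\<lambda>f. (stat n g f - measure_pmf.expectation (step n B x) (stat n g))\<^sup>2) \<le> 580 * real n"
proof -
  define h where "h tgt = measure_pmf.expectation (updates n B x tgt) (stat n g)" for tgt
  define m where "m = measure_pmf.expectation (step n B x) (stat n g)"
  have m: "m = measure_pmf.expectation (targets n) h"
    unfolding m_def h_def expectation_step[OF n] ..
  have "measure_pmf.expectation (updates n B x tgt) (\<lambda>f. (stat n g f - h tgt)\<^sup>2) \<le> real (card {..<n}) * 2\<^sup>2" for tgt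
    unfolding h_def updates_def
  proof (rule variance_Pi_pmf_bounded_differences)
    fix v f y z assume v: "v \<in> {..<n}"
    have "stat n g (f(v := w)) = g w + (\<Sum>v\<in>{..<n} - {v}. g (f v))" for w
      unfolding stat_def using v by (subst sum.remove[of _ v]) auto
    then show "\<bar>stat n g (f(v := y)) - stat n g (f(v := z))\<bar> \<le> 2"
      using g[of y] g[of z] by simp
  qed (auto intro: finite_set_node_update)
  then have 1: "measure_pmf.expectation (updates n B x tgt) (\<lambda>f. (stat n g f - m)\<^sup>2) \<le> 4 * real n + (h tgt - m)\<^sup>2" for tgt
    using expectation_square_split[OF finite_set_updates, of n B x tgt "stat n g" m] by (simp add: h_def mult.commute)
  have 2: "measure_pmf.expectation (targets n) (\<lambda>tgt. (h tgt - m)\<^sup>2) \<le> real (card {..<n}) * 24\<^sup>2"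
    unfolding m targets_def
  proof (rule variance_Pi_pmf_bounded_differences)
    show "\<bar>h (t(u := y)) - h (t(u := z))\<bar> \<le> 24" for u t y z
      unfolding h_def by (rule expectation_updates_stat_bounded_differences[OF g])
  qed (use n in \<open>auto intro!: finite_set_pmf_Pi_pmf simp: set_pmf_of_lessThan\<close>)
  have "measure_pmf.expectation (step n B x) (\<lambda>f. (stat n g f - m)\<^sup>2) \<le>
     measure_pmf.expectation (targets n) (\<lambda>tgt. 4 * real n + (h tgt - m)\<^sup>2)"
    unfolding expectation_step[OF n] by (intro expectation_mono_finite finite_set_targets n 1)
  also have "\<dots> = 4 * real n + measure_pmf.expectation (targets n) (\<lambda>tgt. (h tgt - m)\<^sup>2)"
    by (simp add: integrable_measure_pmf_finite finite_set_targets n)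
  finally show ?thesis using 2 unfolding m_def by simp
qed

lemma expectation_step_stat:
  assumes n: "n > 0"
  shows "measure_pmf.expectation (step n B x) (stat n g) =
    (\<Sum>v<n. measure_pmf.expectation (targets n) (\<lambda>tgt. node_mean g (v \<in> B) (deliver n 6 x tgt v)))"
  unfolding expectation_step[OF n] expectation_updates_stat
  by (subst Bochner_Integration.integral_sum) (auto intro: integrable_measure_pmf_finite finite_set_targets n)

section \<open>Exact mean of a round\<close>

definition cnt :: "nat \<Rightarrow> (nat \<Rightarrow> bool option) \<Rightarrow> bool \<Rightarrow> nat" where
  "cnt n x b = card {u\<in>{..<n}. x u = Some b}"

text \<open>The probability that a binomial variable with \<open>M\<close> trials and success
  probability \<open>1 / n\<close> is at least 3, that is, that an unblocked node receives enough of
  \<open>M\<close> messages to stay defined.\<close>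

definition reach :: "nat \<Rightarrow> nat \<Rightarrow> real" where
  "reach n M = (\<Sum>k\<in>{3..M}. real (M choose k) * ((1 / real n) ^ k * (1 - 1 / real n) ^ (M - k)))"

lemma card_all_msgs: "card (msgs n x True \<union> msgs n x False) = 6 * (cnt n x True + cnt n x False)"
  using msgs_disjoint[of n x True] by (subst card_Un_disjoint) (auto simp: card_msgs cnt_def)

lemma sum_Pow_reach:
  assumes "finite P"
  shows "(\<Sum>S\<in>{S\<in>Pow P. card S \<ge> 3}. (1 / real n) ^ card S * (1 - 1 / real n) ^ (card P - card S)) = reach n (card P)"
proof -
  let ?w = "\<lambda>k. (1 / real n) ^ k * (1 - 1 / real n) ^ (card P - k)"
  have "(\<Sum>S\<in>{S\<in>Pow P. card S \<ge> 3}. ?w (card S)) = (\<Sum>S\<in>Pow P. if card S \<ge> 3 then ?w (card S) else 0)"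
    using assms by (intro sum.inter_filter) simp
  also have "\<dots> = (\<Sum>k\<le>card P. real (card P choose k) * (if k \<ge> 3 then ?w k else 0))"
    using assms by (rule sum_Pow_card)
  also have "\<dots> = (\<Sum>k\<in>{3..card P}. real (card P choose k) * ?w k)"
    by (intro sum.mono_neutral_cong_right) auto
  finally show ?thesis by (simp add: reach_def)
qed

definition is_defined :: "bool option \<Rightarrow> real" where
  "is_defined y = (if y = None then 0 else 1)"

definition vote :: "bool \<Rightarrow> bool option \<Rightarrow> real" where
  "vote b y = indicator {Some b} y - indicator {Some (\<not> b)} y"

lemma expectation_defined:
  assumes n: "n > 0" and v: "v < n"
  shows "measure_pmf.expectation (targets n) (\<lambda>tgt. node_mean is_defined False (deliver n 6 x tgt v)) =
    reach n (6 * (cnt n x True + cnt n x False))"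
proof -
  let ?P = "msgs n x True \<union> msgs n x False"
  have "node_mean is_defined False (deliver n 6 x tgt v) = (if card (received n x v tgt) \<ge> 3 then 1 else 0)" for tgt
    by (simp add: node_mean_def node_update_def length_deliver[OF v] is_defined_def)
  then have "measure_pmf.expectation (targets n) (\<lambda>tgt. node_mean is_defined False (deliver n 6 x tgt v)) =
     measure_pmf.expectation (targets n) (\<lambda>tgt. (\<lambda>S. if card S \<ge> 3 then 1 else 0) (received n x v tgt))" by simp
  also have "\<dots> = (\<Sum>S\<in>Pow ?P. (if card S \<ge> 3 then 1 else 0) * ((1 / real n) ^ card S * (1 - 1 / real n) ^ (card ?P - card S)))"
    by (rule expectation_received[OF n v])
  also have "\<dots> = (\<Sum>S\<in>{S\<in>Pow ?P. card S \<ge> 3}. (1 / real n) ^ card S * (1 - 1 / real n) ^ (card ?P - card S))"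
    by (subst sum.inter_filter) (auto intro!: sum.cong)
  also have "\<dots> = reach n (card ?P)" by (rule sum_Pow_reach) simp
  finally show ?thesis unfolding card_all_msgs .
qed

text \<open>Given the received set \<open>S\<close>, the mean vote is the number of triples in
  \<open>S\<close> won by \<open>b\<close> minus the number won by the opponent, relative to all
  triples in \<open>S\<close>. By \<open>uniform_triple\<close>, averaging over \<open>S\<close>
  turns each share into the corresponding share among all messages sent, times the probability of
  receiving at least three.\<close>

lemma expectation_vote:
  fixes x :: "nat \<Rightarrow> bool option"
  assumes n: "n > 0" and v: "v < n"
  defines "A \<equiv> \<lambda>c. 6 * cnt n x c"
  assumes M: "A b + A (\<not> b) \<ge> 3"
  shows "measure_pmf.expectation (targets n) (\<lambda>tgt. node_mean (vote b) False (deliver n 6 x tgt v)) =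
    (real (majority_triples (A b) (A (\<not> b))) - real (majority_triples (A (\<not> b)) (A b))) / real ((A b + A (\<not> b)) choose 3)
     * reach n (A b + A (\<not> b))"
proof -
  let ?P = "msgs n x True \<union> msgs n x False"
  define F where "F c = {T. T \<subseteq> ?P \<and> card T = 3 \<and> card (T \<inter> msgs n x c) \<ge> 2}" for c
  define w where "w k = (1 / real n) ^ k * (1 - 1 / real n) ^ (card ?P - k)" for k
  define f where "f S = (if card S \<ge> 3 then (real (card {T\<in>F b. T \<subseteq> S}) - real (card {T\<in>F (\<not> b). T \<subseteq> S})) / real (card S choose 3) else 0)" for S
  have cP: "card ?P = A b + A (\<not> b)" unfolding card_all_msgs A_def by (cases b) auto
  have diff: "S - msgs n x c = S \<inter> msgs n x (\<not> c)" if "S \<subseteq> ?P" for S c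
    using that msgs_disjoint[of n x c] by (cases c) auto
  have cF: "card (F c) = majority_triples (A c) (A (\<not> c))" for c
  proof -
    have "msgs n x c \<subseteq> ?P" "?P - msgs n x c = msgs n x (\<not> c)"
      using msgs_disjoint[of n x c] by (cases c; auto)+
    then show ?thesis using card_majority_triples[of ?P "msgs n x c"]
      by (simp add: F_def A_def cnt_def card_msgs)
  qed
  have cS: "card {T\<in>F c. T \<subseteq> S} = majority_triples (card (S \<inter> msgs n x c)) (card (S \<inter> msgs n x (\<not> c)))" if S: "S \<subseteq> ?P" for S c
  proof -
    have fS: "finite S" using S by (rule finite_subset) simp
    have "{T\<in>F c. T \<subseteq> S} = {T. T \<subseteq> S \<and> card T = 3 \<and> card (T \<inter> (S \<inter> msgs n x c)) \<ge> 2}"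
      using S unfolding F_def by (auto simp: Int_absorb2 Int_assoc[symmetric])
    moreover have "S - S \<inter> msgs n x c = S \<inter> msgs n x (\<not> c)" using diff[OF S] by auto
    ultimately show ?thesis using card_majority_triples[OF fS, of "S \<inter> msgs n x c"] by simp
  qed
  have "node_mean (vote b) False (deliver n 6 x tgt v) = f (received n x v tgt)" for tgt
  proof (cases "card (received n x v tgt) \<ge> 3")
    case True
    have R: "received n x v tgt \<subseteq> ?P" by (auto simp: received_def)
    let ?p = "node_update 3 False False None (deliver n 6 x tgt v)"
    have "node_mean (vote b) False (deliver n 6 x tgt v) = measure_pmf.prob ?p {Some b} - measure_pmf.prob ?p {Some (\<not> b)}"
      unfolding node_mean_def vote_def by (subst Bochner_Integration.integral_diff)
        (auto intro: integrable_measure_pmf_finite finite_set_node_update)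
    then show ?thesis
      using True cS[OF R]
      by (simp add: prob_node_update length_deliver[OF v] count_deliver[OF v] f_def diff_divide_distrib)
  next
    case False
    then show ?thesis by (simp add: node_mean_def node_update_def length_deliver[OF v] vote_def f_def)
  qed
  then have "measure_pmf.expectation (targets n) (\<lambda>tgt. node_mean (vote b) False (deliver n 6 x tgt v)) =
     (\<Sum>S\<in>Pow ?P. f S * w (card S))"
    using expectation_received[OF n v, of f x] by (simp add: w_def)
  also have "\<dots> = (\<Sum>S\<in>{S\<in>Pow ?P. card S \<ge> 3}. f S * w (card S))"
    by (rule sum.mono_neutral_right) (auto simp: f_def)
  also have "\<dots> = (\<Sum>S\<in>{S\<in>Pow ?P. card S \<ge> 3}. w (card S) * (real (card {T\<in>F b. T \<subseteq> S}) / real (card S choose 3))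
       - w (card S) * (real (card {T\<in>F (\<not> b). T \<subseteq> S}) / real (card S choose 3)))"
    by (intro sum.cong) (auto simp: f_def diff_divide_distrib algebra_simps)
  also have "\<dots> = real (card (F b)) / real (card ?P choose 3) * reach n (card ?P)
      - real (card (F (\<not> b))) / real (card ?P choose 3) * reach n (card ?P)"
    using M cP uniform_triple[of ?P "F b" w] uniform_triple[of ?P "F (\<not> b)" w] sum_Pow_reach[of ?P n]
    unfolding sum_subtractf by (simp add: F_def w_def)
  finally show ?thesis unfolding cF cP by (simp add: diff_divide_distrib left_diff_distrib)
qed

section \<open>Tail bounds for the number of messages received by a node\<close>

lemma reach_nonneg: "n > 0 \<Longrightarrow> reach n M \<ge> 0"
  unfolding reach_def by (intro sum_nonneg mult_nonneg_nonneg zero_le_power) auto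

text \<open>Up to the loss 2/n this is the Poisson tail of parameter \<open>s\<close>. A larger mean
  \<open>s + t\<close> is harmless: the quadratic grows by a factor of at most 1 + t + t^2/2 \<le>
  exp t, which cancels against exp(-t).\<close>

lemma reach_ge:
  assumes n: "n \<ge> 2" and s: "s \<ge> 1" and M: "real M \<ge> s * real n"
  shows "reach n M \<ge> 1 - (1 + s + s\<^sup>2 / 2) / exp (s - 2 / real n)"
proof -
  define t where "t = real M / real n - s"
  have t: "t \<ge> 0" using M n unfolding t_def by (simp add: field_simps)
  have st: "real M / real n = s + t" unfolding t_def by simp
  have M2: "M \<ge> 2" using M n s
    by (smt (verit, best) mult_le_cancel_right1 numeral_le_real_of_nat_iff of_nat_0_le_iff of_nat_le_iff order_trans)
  let ?p = "1 / real n"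
  let ?w = "\<lambda>k. real (M choose k) * (?p ^ k * (1 - ?p) ^ (M - k))"
  have p: "0 \<le> 1 - ?p" "1 - ?p \<le> 1" using n by auto
  have "1 = (?p + (1 - ?p)) ^ M" by simp
  also have "\<dots> = (\<Sum>k\<le>M. ?w k)" unfolding binomial_ring by (simp add: mult.assoc)
  also have "\<dots> = (\<Sum>k\<in>{..2}. ?w k) + (\<Sum>k\<in>{3..M}. ?w k)"
    using M2 by (subst sum.union_disjoint[symmetric]) (auto intro!: sum.cong)
  finally have "1 - reach n M = (\<Sum>k\<in>{..2}. ?w k)" by (simp add: reach_def)
  also have "\<dots> = (1 - ?p) ^ M + real M * (?p * (1 - ?p) ^ (M - 1)) + real (M choose 2) * (?p\<^sup>2 * (1 - ?p) ^ (M - 2))"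
    by (simp add: eval_nat_numeral)
  \<comment> \<open>Lowering all exponents to \<open>M - 2\<close> allows a common factor to be
    extracted; this is the source of the term 2/n.\<close>
  also have "\<dots> \<le> (1 - ?p) ^ (M - 2) + real M * (?p * (1 - ?p) ^ (M - 2)) + real M ^ 2 / 2 * (?p\<^sup>2 * (1 - ?p) ^ (M - 2))"
    using p by (intro add_mono mult_mono power_decreasing) (auto simp: real_choose_2 power2_eq_square field_simps)
  also have "\<dots> = (1 - ?p) ^ (M - 2) * (1 + real M / real n + (real M / real n)\<^sup>2 / 2)"
    by (simp add: algebra_simps power_divide)
  also have "\<dots> \<le> exp (- (s + t) + 2 / real n) * ((1 + s + s\<^sup>2 / 2) * exp t)"
  proof (rule mult_mono)
    have "(1 - ?p) ^ (M - 2) \<le> exp (- ?p) ^ (M - 2)"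
      using p exp_ge_add_one_self[of "- ?p"] by (intro power_mono) auto
    also have "\<dots> = exp (- (real (M - 2) / real n))" by (simp add: exp_of_nat_mult[symmetric])
    also have "- (real (M - 2) / real n) = - (s + t) + 2 / real n"
      unfolding st[symmetric] using M2 by (simp add: diff_divide_distrib)
    finally show "(1 - ?p) ^ (M - 2) \<le> exp (- (s + t) + 2 / real n)" .
    have "s * t \<le> s * t + s\<^sup>2 / 2 * t + (s + s\<^sup>2 / 2) * (t\<^sup>2 / 2)"
      using s t by simp
    then have "1 + (s + t) + (s + t)\<^sup>2 / 2 \<le> (1 + s + s\<^sup>2 / 2) * (1 + t + t\<^sup>2 / 2)"
      by (simp add: power2_eq_square algebra_simps)
    also have "\<dots> \<le> (1 + s + s\<^sup>2 / 2) * exp t"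
      using s by (intro mult_left_mono exp_lower_Taylor_quadratic t) auto
    finally show "1 + real M / real n + (real M / real n)\<^sup>2 / 2 \<le> (1 + s + s\<^sup>2 / 2) * exp t" unfolding st .
  qed (use s t st in auto)
  also have "\<dots> = (1 + s + s\<^sup>2 / 2) / exp (s - 2 / real n)"
    by (simp add: exp_diff exp_add exp_minus field_simps)
  finally show ?thesis by simp
qed

text \<open>Rational lower bounds for the numerical estimates: 145/128 is 1 + x + x^2/2 at x = 1/8,
  and the factor 99/100 pays for 2/n when n is at least 200.\<close>

lemma exp_nat_lower: "exp (real k - 2 / real n) \<ge> 99 / 100 * (145 / 128) ^ (8 * k)" if "n \<ge> 200"
proof -
  have "(145 / 128 :: real) \<le> exp (1 / 8)"
    using exp_lower_Taylor_quadratic[of "1/8"] by (simp add: power2_eq_square)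
  then have "(145 / 128 :: real) ^ (8 * k) \<le> exp (1 / 8) ^ (8 * k)" by (intro power_mono) auto
  also have "\<dots> = exp (real k)" by (simp add: exp_of_nat_mult[symmetric])
  finally have 1: "(145 / 128 :: real) ^ (8 * k) \<le> exp (real k)" .
  have "99 / 100 \<le> 1 + (- (2 / real n))" using that by (simp add: field_simps)
  also have "\<dots> \<le> exp (- (2 / real n))" by (rule exp_ge_add_one_self)
  finally have "99 / 100 * (145 / 128) ^ (8 * k) \<le> exp (- (2 / real n)) * exp (real k)"
    by (intro mult_mono 1) auto
  then show ?thesis by (simp add: exp_diff exp_minus field_simps)
qed

text \<open>The numerator in \<open>reach_ge\<close> is 1 + 4 + 8 = 13, so a lower bound of 52 for
  the exponential limits the failure probability to 1/4.\<close>

lemma reach_ge_4: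
  assumes "n \<ge> 200" "real M \<ge> 4 * real n"
  shows "reach n M \<ge> 3 / 4"
proof -
  have e: "exp (4 - 2 / real n) \<ge> 52"
  proof -
    have "52 \<le> 99 / 100 * (145 / 128 :: real) ^ (8 * 4)" by (simp add: power_divide)
    also have "\<dots> \<le> exp (4 - 2 / real n)" using exp_nat_lower[of n 4] assms by simp
    finally show ?thesis .
  qed
  have "13 / exp (4 - 2 / real n) \<le> 13 / 52" by (rule divide_left_mono) (use e in auto)
  moreover have "1 - 13 / exp (4 - 2 / real n) \<le> reach n M" using reach_ge[of n 4 M] assms by simp
  ultimately show ?thesis by linarith
qed

lemma reach_ge_5:
  assumes "n \<ge> 200" "real M \<ge> 5 * real n"
  shows "reach n M \<ge> 87 / 100"
proof -
  have e: "exp (5 - 2 / real n) \<ge> 1850 / 13"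
  proof -
    have "1850 / 13 \<le> 99 / 100 * (145 / 128 :: real) ^ (8 * 5)" by (simp add: power_divide)
    also have "\<dots> \<le> exp (5 - 2 / real n)" using exp_nat_lower[of n 5] assms by simp
    finally show ?thesis .
  qed
  define c where "c = (37 / 2) / exp (5 - 2 / real n)"
  have "c \<le> (37 / 2) / (1850 / 13)" unfolding c_def by (rule divide_left_mono) (use e in auto)
  then have "c \<le> 13 / 100" by simp
  moreover have "1 - c \<le> reach n M" unfolding c_def using reach_ge[of n 5 M] assms by simp
  ultimately show ?thesis by linarith
qed

section \<open>Drift of the gap\<close>

text \<open>All unblocked nodes have the same mean and blocked ones contribute
  \<open>g None = 0\<close>, so the adversary's choice enters only through the cardinality of
  \<open>B\<close>.\<close>

lemma expectation_step_stat_unblocked: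
  assumes n: "n > 0" and B: "B \<subseteq> {..<n}" and g: "g None = 0"
    and m: "\<And>v. v < n \<Longrightarrow> measure_pmf.expectation (targets n) (\<lambda>tgt. node_mean g False (deliver n 6 x tgt v)) = m"
  shows "measure_pmf.expectation (step n B x) (stat n g) = (real n - real (card B)) * m"
proof -
  have fB: "finite B" using B finite_subset by blast
  have "measure_pmf.expectation (step n B x) (stat n g) = (\<Sum>v<n. if v \<in> B then 0 else m)"
    unfolding expectation_step_stat[OF n]
    by (intro sum.cong) (auto simp: m, simp add: node_mean_def node_update_def g)
  also have "\<dots> = real (card ({..<n} - B)) * m"
    by (simp add: sum.If_cases Diff_eq)
  also have "real (card ({..<n} - B)) = real n - real (card B)"
    using B fB card_mono[OF _ B] by (simp add: card_Diff_subset of_nat_diff)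
  finally show ?thesis .
qed

lemma cnt_add_le: "cnt n x b + cnt n x (\<not> b) \<le> n"
proof -
  have "cnt n x b + cnt n x (\<not> b) = card ({u\<in>{..<n}. x u = Some b} \<union> {u\<in>{..<n}. x u = Some (\<not> b)})"
    unfolding cnt_def by (subst card_Un_disjoint) auto
  also have "\<dots> \<le> card {..<n}" by (rule card_mono) auto
  finally show ?thesis by simp
qed

lemma cnt_add_cases: "cnt n x b + cnt n x (\<not> b) = cnt n x True + cnt n x False"
  by (cases b) auto

lemma sum_indicator_cnt: "(\<Sum>v<n. indicator {Some b} (x v)) = real (cnt n x b)"
proof -
  have "(\<Sum>v<n. indicator {Some b} (x v)) = (\<Sum>v<n. if x v = Some b then 1 else (0::real))"
    by (intro sum.cong) (auto simp: indicator_def)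
  also have "\<dots> = (\<Sum>v\<in>{v\<in>{..<n}. x v = Some b}. 1)" by (rule sum.inter_filter[symmetric]) simp
  finally show ?thesis by (simp add: cnt_def)
qed

lemma stat_vote: "stat n (vote b) x = real (cnt n x b) - real (cnt n x (\<not> b))"
  unfolding stat_def vote_def sum_subtractf sum_indicator_cnt ..

lemma stat_is_defined: "stat n is_defined x = real (cnt n x True) + real (cnt n x False)"
proof -
  have "is_defined y = indicator {Some True} y + indicator {Some False} y" for y
    by (cases y) (auto simp: is_defined_def indicator_def)
  then show ?thesis unfolding stat_def by (simp add: sum.distrib sum_indicator_cnt)
qed

definition mostly_defined :: "nat \<Rightarrow> (nat \<Rightarrow> bool option) \<Rightarrow> bool" where
  "mostly_defined n x \<longleftrightarrow> 2 * n \<le> 3 * (cnt n x True + cnt n x False)"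

definition gap :: "nat \<Rightarrow> (nat \<Rightarrow> bool option) \<Rightarrow> real" where
  "gap n x = \<bar>real (cnt n x True) - real (cnt n x False)\<bar>"

lemma mostly_defined_step:
  assumes n: "n \<ge> 200" and B: "B \<subseteq> {..<n}" "real (card B) \<le> real n / 16" and x: "mostly_defined n x"
  shows "measure_pmf.prob (step n B x) {x'. \<not> mostly_defined n x'} \<le> 500000 / real n"
proof -
  have n0: "n > 0" using n by simp
  let ?M = "6 * (cnt n x True + cnt n x False)"
  let ?m = "measure_pmf.expectation (step n B x) (stat n is_defined)"
  have r: "reach n ?M \<ge> 3 / 4"
    by (rule reach_ge_4[OF n]) (use x in \<open>simp add: mostly_defined_def\<close>)
  have "?m = (real n - real (card B)) * reach n ?M"
    by (rule expectation_step_stat_unblocked[OF n0 B(1)]) (auto simp: is_defined_def expectation_defined[OF n0])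
  also have "\<dots> \<ge> (15 / 16 * real n) * (3 / 4)"
    using B(2) r by (intro mult_mono) auto
  finally have m: "?m \<ge> 45 / 64 * real n" by simp
  \<comment> \<open>The deviation 36/1000 fits into the slack 45/64 - 2/3.\<close>
  have "measure_pmf.prob (step n B x) {x'. \<not> mostly_defined n x'} \<le>
      measure_pmf.prob (step n B x) {x'. \<bar>stat n is_defined x' - ?m\<bar> \<ge> 36 / 1000 * real n}"
  proof (rule measure_pmf.finite_measure_mono)
    show "{x'. \<not> mostly_defined n x'} \<subseteq> {x'. \<bar>stat n is_defined x' - ?m\<bar> \<ge> 36 / 1000 * real n}"
      using m by (auto simp: mostly_defined_def stat_is_defined)
  qed simp
  also have "\<dots> \<le> 580 * real n / (36 / 1000 * real n)\<^sup>2"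
    by (rule chebyshev_finite[OF finite_set_step _ variance_step_stat]) (use n in \<open>auto simp: is_defined_def\<close>)
  also have "\<dots> \<le> 500000 / real n"
    using n by (simp add: field_simps power2_eq_square)
  finally show ?thesis .
qed

lemma cubic_mono:
  fixes \<beta> \<gamma> :: real
  assumes "0 \<le> \<gamma>" "\<gamma> \<le> \<beta>" "\<beta> \<le> 1"
  shows "\<gamma> * (3 - \<gamma>\<^sup>2) \<le> \<beta> * (3 - \<beta>\<^sup>2)"
proof -
  have "\<beta>\<^sup>2 \<le> 1" "\<gamma>\<^sup>2 \<le> 1" "\<beta> * \<gamma> \<le> 1"
    using assms by (auto intro: power_le_one mult_le_one)
  then have "0 \<le> (\<beta> - \<gamma>) * (3 - \<beta>\<^sup>2 - \<beta> * \<gamma> - \<gamma>\<^sup>2)"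
    using assms by (intro mult_nonneg_nonneg) auto
  then show ?thesis by (simp add: algebra_simps power2_eq_square)
qed

text \<open>The bound is stated for any \<open>y\<close> below the gap, so that a gap beyond 0.36n
  can be treated as if it were 0.36n; \<open>cubic_mono\<close> justifies this. The bias is at least
  \<open>y / D\<close> for \<open>D\<close> defined nodes, and the chance to receive three messages
  is at least proportional to \<open>D\<close>, so \<open>D\<close> cancels.\<close>

lemma expectation_vote_ge:
  assumes n: "n \<ge> 200" and B: "B \<subseteq> {..<n}" "real (card B) \<le> real n / 16" and x: "mostly_defined n x"
    and y: "0 \<le> y" "y \<le> real (cnt n x b) - real (cnt n x (\<not> b))" "y \<le> 36 / 100 * real n"
  shows "measure_pmf.expectation (step n B x) (stat n (vote b)) \<ge> 11 / 10 * y"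
proof -
  have n0: "n > 0" using n by simp
  define A where "A = (\<lambda>c. 6 * cnt n x c)"
  define D where "D = real (cnt n x b) + real (cnt n x (\<not> b))"
  define q where "q = reach n (A b + A (\<not> b))"
  define \<beta> where "\<beta> = (real (A b) - real (A (\<not> b))) / (real (A b) + real (A (\<not> b)))"
  define \<rho> where "\<rho> = (real (majority_triples (A b) (A (\<not> b))) - real (majority_triples (A (\<not> b)) (A b))) / real ((A b + A (\<not> b)) choose 3)"
  have D: "2 / 3 * real n \<le> D" "D \<le> real n"
  proof -
    have "2 * n \<le> 3 * (cnt n x b + cnt n x (\<not> b))" using x cnt_add_cases[of n x b] by (simp add: mostly_defined_def)
    then have "real (2 * n) \<le> real (3 * (cnt n x b + cnt n x (\<not> b)))" by (rule of_nat_mono)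
    then show "2 / 3 * real n \<le> D" by (simp add: D_def)
    have "real (cnt n x b + cnt n x (\<not> b)) \<le> real n" using cnt_add_le by (rule of_nat_mono)
    then show "D \<le> real n" by (simp add: D_def)
  qed
  have D0: "D > 0" using D n by simp
  have M: "real (A b + A (\<not> b)) = 6 * D" unfolding A_def D_def by simp
  have M3: "A b + A (\<not> b) \<ge> 3" using M D n by linarith
  have \<beta>: "\<beta> = (real (cnt n x b) - real (cnt n x (\<not> b))) / D"
    unfolding \<beta>_def A_def D_def of_nat_mult distrib_left[symmetric] right_diff_distrib[symmetric]
    by (rule mult_divide_mult_cancel_left) simp
  define \<gamma> where "\<gamma> = y / D"
  have \<gamma>: "0 \<le> \<gamma>" "\<gamma> \<le> \<beta>" "\<beta> \<le> 1" "\<gamma> \<le> 54 / 100"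
  proof -
    show "0 \<le> \<gamma>" "\<gamma> \<le> \<beta>" unfolding \<gamma>_def \<beta> using y D0 by (auto simp: divide_right_mono)
    show "\<beta> \<le> 1" unfolding \<beta> using D0 unfolding D_def by (simp add: field_simps)
    show "\<gamma> \<le> 54 / 100" unfolding \<gamma>_def using y D D0 by (simp add: field_simps)
  qed
  \<comment> \<open>1.3542 is (3 - 0.54^2)/2, the growth of the bias at the largest
    \<gamma>.\<close>
  have "\<gamma> * (13542 / 10000) \<le> \<gamma> * ((3 - \<gamma>\<^sup>2) / 2)"
  proof (rule mult_left_mono)
    have "\<gamma>\<^sup>2 \<le> (54 / 100)\<^sup>2" using \<gamma> by (intro power_mono) auto
    then show "13542 / 10000 \<le> (3 - \<gamma>\<^sup>2) / 2" by (simp add: power2_eq_square)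
  qed (use \<gamma> in auto)
  also have "\<dots> \<le> \<beta> * (3 - \<beta>\<^sup>2) / 2" using cubic_mono[OF \<gamma>(1-3)] by simp
  also have "\<dots> \<le> \<rho>" unfolding \<beta>_def \<rho>_def
    by (rule majority_triples_difference) (use y M3 in \<open>auto simp: A_def\<close>)
  finally have \<rho>: "\<gamma> * (13542 / 10000) \<le> \<rho>" .
  \<comment> \<open>A linear bound in \<open>D\<close> from two values: 0.87 suffices as
    \<open>D\<close> is at most \<open>n\<close>, and below 5n/6 the bound 3/4 suffices because 0.87
    * 5/6 = 0.725.\<close>
  have q: "q \<ge> 87 / 100 * (D / real n)"
  proof (cases "D \<ge> 5 / 6 * real n")
    case True
    then have "q \<ge> 87 / 100" unfolding q_def using M by (intro reach_ge_5[OF n]) simp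
    moreover have "D / real n \<le> 1" using D n by simp
    ultimately show ?thesis by linarith
  next
    case False
    have "q \<ge> 3 / 4" unfolding q_def using M D by (intro reach_ge_4[OF n]) simp
    moreover have "D / real n \<le> 5 / 6" using False n by (simp add: field_simps)
    ultimately show ?thesis by linarith
  qed
  have q0: "q \<ge> 0" unfolding q_def by (rule reach_nonneg[OF n0])
  have "measure_pmf.expectation (step n B x) (stat n (vote b)) = (real n - real (card B)) * (\<rho> * q)"
    by (rule expectation_step_stat_unblocked[OF n0 B(1)])
       (use M3 in \<open>auto simp: vote_def expectation_vote[OF n0] \<rho>_def q_def A_def\<close>)
  also have "\<dots> \<ge> (15 / 16 * real n) * ((\<gamma> * (13542 / 10000)) * (87 / 100 * (D / real n)))"
    using B(2) \<rho> q q0 \<gamma> D0 n by (intro mult_mono) auto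
  \<comment> \<open>The product of the constants is about 1.1045.\<close>
  also have "(15 / 16 * real n) * ((\<gamma> * (13542 / 10000)) * (87 / 100 * (D / real n))) = 15 / 16 * (13542 / 10000) * (87 / 100) * y"
    unfolding \<gamma>_def using n D0 by (simp add: field_simps)
  also have "\<dots> \<ge> 11 / 10 * y" using y by (intro mult_right_mono) auto
  finally show ?thesis .
qed

lemma gap_growth:
  assumes n: "n \<ge> 200" and B: "B \<subseteq> {..<n}" "real (card B) \<le> real n / 16" and x: "mostly_defined n x"
    and y: "0 < y" "y \<le> gap n x" "y \<le> 36 / 100 * real n"
  shows "measure_pmf.prob (step n B x) {x'. gap n x' < 21 / 20 * y} \<le> 232000 * real n / y\<^sup>2"
proof -
  obtain b where b: "gap n x = real (cnt n x b) - real (cnt n x (\<not> b))"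
  proof (cases "cnt n x True \<ge> cnt n x False")
    case True
    then show ?thesis by (intro that[of True]) (simp add: gap_def)
  next
    case False
    then show ?thesis by (intro that[of False]) (simp add: gap_def)
  qed
  let ?m = "measure_pmf.expectation (step n B x) (stat n (vote b))"
  have m: "?m \<ge> 11 / 10 * y" using assms b by (intro expectation_vote_ge) auto
  have g: "stat n (vote b) x' \<le> gap n x'" for x' unfolding stat_vote gap_def by (cases b) auto
  \<comment> \<open>Half of the mean growth is kept; the other half, y/20, is the deviation, and 580
    * 20^2 = 232000.\<close>
  have "measure_pmf.prob (step n B x) {x'. gap n x' < 21 / 20 * y} \<le>
      measure_pmf.prob (step n B x) {x'. \<bar>stat n (vote b) x' - ?m\<bar> \<ge> 1 / 20 * y}"
  proof (rule measure_pmf.finite_measure_mono)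
    show "{x'. gap n x' < 21 / 20 * y} \<subseteq> {x'. \<bar>stat n (vote b) x' - ?m\<bar> \<ge> 1 / 20 * y}"
    proof safe
      fix x' assume "gap n x' < 21 / 20 * y"
      then show "\<bar>stat n (vote b) x' - ?m\<bar> \<ge> 1 / 20 * y" using m g[of x'] by linarith
    qed
  qed simp
  also have "\<dots> \<le> 580 * real n / (1 / 20 * y)\<^sup>2"
    by (rule chebyshev_finite[OF finite_set_step _ variance_step_stat]) (use n y in \<open>auto simp: vote_def indicator_def\<close>)
  also have "\<dots> = 232000 * real n / y\<^sup>2"
    using y by (simp add: field_simps power2_eq_square)
  finally show ?thesis .
qed

section \<open>Anticoncentration of a sum of votes with many fair coins among them\<close>

definition ivote :: "bool option \<Rightarrow> int" where
  "ivote y = (case y of None \<Rightarrow> 0 | Some b \<Rightarrow> if b then 1 else - 1)"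

lemma vote_ivote: "vote True y = real_of_int (ivote y)"
  by (auto simp: vote_def ivote_def indicator_def split: option.split)

lemma sum_ivote_walk:
  assumes "finite Q"
  shows "map_pmf (\<lambda>f. \<Sum>v\<in>Q. ivote (f v)) (Pi_pmf Q None (\<lambda>_. pmf_of_set {Some True, Some False})) = walk (card Q)"
  using assms
proof (induction Q rule: finite_induct)
  case (insert a Q)
  let ?P = "Pi_pmf Q None (\<lambda>_. pmf_of_set {Some True, Some False})"
  have iv: "map_pmf ivote (pmf_of_set {Some True, Some False}) = pmf_of_set {1, -1}"
    by (subst map_pmf_of_set_inj) (auto simp: ivote_def inj_on_def)
  have s: "(\<Sum>v\<in>insert a Q. ivote ((f(a := y)) v)) = ivote y + (\<Sum>v\<in>Q. ivote (f v))" for f y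
    using insert(1,2) by (simp, intro sum.cong) auto
  have "map_pmf (\<lambda>f. \<Sum>v\<in>insert a Q. ivote (f v)) (Pi_pmf (insert a Q) None (\<lambda>_. pmf_of_set {Some True, Some False})) =
     do { s \<leftarrow> map_pmf ivote (pmf_of_set {Some True, Some False}); r \<leftarrow> map_pmf (\<lambda>f. \<Sum>v\<in>Q. ivote (f v)) ?P; return_pmf (s + r) }"
    unfolding Pi_pmf_insert'[OF insert(1,2)]
    by (simp only: map_bind_pmf bind_map_pmf map_return_pmf s)
  then show ?case unfolding iv insert.IH using insert(1,2) by simp
qed simp

text \<open>Given the remaining votes, adding a symmetric sum pushes the total away from 0 in one of the two directions.\<close>

lemma fair_votes_anticoncentration:
  fixes p :: "nat \<Rightarrow> bool option pmf"
  assumes Q: "Q \<subseteq> {..<n}" and fair: "\<And>v. v \<in> Q \<Longrightarrow> p v = pmf_of_set {Some True, Some False}"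
    and fin: "\<And>v. v < n \<Longrightarrow> finite (set_pmf (p v))"
  shows "measure_pmf.prob (Pi_pmf {..<n} None p) {x. \<bar>stat n (vote True) x\<bar> \<ge> t} \<ge>
    measure_pmf.prob (walk (card Q)) {r. real_of_int r \<ge> t}"
proof -
  let ?R = "{..<n} - Q"
  let ?w = "measure_pmf.prob (walk (card Q)) {r. real_of_int r \<ge> t}"
  let ?ind = "indicat_real {x. \<bar>stat n (vote True) x\<bar> \<ge> t}"
  let ?S = "\<lambda>f. \<Sum>v\<in>Q. ivote (f v)"
  have fQ: "finite Q" using Q finite_subset by blast
  have finQ: "finite (set_pmf (Pi_pmf Q None p))" by (rule finite_set_pmf_Pi_pmf) (use fQ Q fin in auto)
  have finR: "finite (set_pmf (Pi_pmf ?R None p))" by (rule finite_set_pmf_Pi_pmf) (use fin in auto)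
  have walk: "map_pmf ?S (Pi_pmf Q None p) = walk (card Q)"
    using sum_ivote_walk[OF fQ] Pi_pmf_cong[of Q Q None None p "\<lambda>_. pmf_of_set {Some True, Some False}"] fair by simp
  have A: "{..<n} = ?R \<union> Q" using Q by auto
  have union: "measure_pmf.expectation (Pi_pmf (?R \<union> Q) None p) h = measure_pmf.expectation (Pi_pmf ?R None p)
      (\<lambda>g. measure_pmf.expectation (Pi_pmf Q None p) (\<lambda>f. h (\<lambda>x. if x \<in> ?R then g x else f x)))" for h :: "_ \<Rightarrow> real"
  proof -
    have "Pi_pmf (?R \<union> Q) None p = map_pmf (\<lambda>(f, g) x. if x \<in> ?R then f x else g x) (pair_pmf (Pi_pmf ?R None p) (Pi_pmf Q None p))"
      by (rule Pi_pmf_union) (use fQ in auto)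
    then show ?thesis by (simp add: pair_pmf_def expectation_bind_pmf_finite finQ finR)
  qed
  have "measure_pmf.prob (Pi_pmf {..<n} None p) {x. \<bar>stat n (vote True) x\<bar> \<ge> t} =
     measure_pmf.expectation (Pi_pmf (?R \<union> Q) None p) ?ind" using A by simp
  also have "\<dots> = measure_pmf.expectation (Pi_pmf ?R None p) (\<lambda>g. measure_pmf.expectation (Pi_pmf Q None p)
       (\<lambda>f. ?ind (\<lambda>x. if x \<in> ?R then g x else f x)))"
    unfolding union by simp
  also have "\<dots> \<ge> ?w"
  proof (rule expectation_ge_const[OF finR])
    fix g
    define r where "r = (\<Sum>v\<in>?R. ivote (g v))"
    have st: "stat n (vote True) (\<lambda>x. if x \<in> ?R then g x else f x) = real_of_int (?S f) + real_of_int r" for f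
    proof -
      have "stat n (vote True) (\<lambda>x. if x \<in> ?R then g x else f x) = (\<Sum>v\<in>?R \<union> Q. vote True (if v \<in> ?R then g v else f v))"
        unfolding stat_def using A by simp
      also have "\<dots> = (\<Sum>v\<in>?R. vote True (g v)) + (\<Sum>v\<in>Q. vote True (f v))"
        by (subst sum.union_disjoint) (use fQ in \<open>auto intro!: arg_cong2[where f="(+)"] sum.cong\<close>)
      finally show ?thesis by (simp add: vote_ivote r_def)
    qed
    have "?w \<le> measure_pmf.expectation (walk (card Q)) (indicat_real {s. \<bar>real_of_int s + real_of_int r\<bar> \<ge> t})"
    proof (cases "r \<ge> 0")
      case True
      have "?w = measure_pmf.expectation (walk (card Q)) (indicat_real {r. real_of_int r \<ge> t})" by simp
      also have "\<dots> \<le> measure_pmf.expectation (walk (card Q)) (indicat_real {s. \<bar>real_of_int s + real_of_int r\<bar> \<ge> t})"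
        by (rule expectation_mono_finite) (use True in \<open>auto simp: indicator_def\<close>)
      finally show ?thesis .
    next
      case False
      have "?w = measure_pmf.expectation (walk (card Q)) (indicat_real {r. - real_of_int r \<ge> t})"
        using prob_walk_uminus[of "card Q" t] by simp
      also have "\<dots> \<le> measure_pmf.expectation (walk (card Q)) (indicat_real {s. \<bar>real_of_int s + real_of_int r\<bar> \<ge> t})"
        by (rule expectation_mono_finite) (use False in \<open>auto simp: indicator_def\<close>)
      finally show ?thesis .
    qed
    also have "\<dots> = measure_pmf.expectation (Pi_pmf Q None p) (\<lambda>f. ?ind (\<lambda>x. if x \<in> ?R then g x else f x))"
      unfolding walk[symmetric] integral_map_pmf by (rule arg_cong[where f="measure_pmf.expectation _"]) (simp only: fun_eq_iff indicator_def mem_Collect_eq st, simp)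
    finally show "?w \<le> measure_pmf.expectation (Pi_pmf Q None p) (\<lambda>f. ?ind (\<lambda>x. if x \<in> ?R then g x else f x))" .
  qed
  finally show ?thesis .
qed

section \<open>Escaping from a small gap\<close>

definition balanced_nodes :: "nat \<Rightarrow> nat set \<Rightarrow> (nat \<Rightarrow> bool option) \<Rightarrow> (nat \<Rightarrow> nat \<Rightarrow> nat) \<Rightarrow> nat set" where
  "balanced_nodes n B x tgt = {v \<in> {..<n} - B. card (received n x v tgt \<inter> msgs n x True) = 2 \<and>
     card (received n x v tgt \<inter> msgs n x False) = 2}"

text \<open>For n \<ge> 2 one has exp(-2/n) \<le> 1/(1 + 2/n) \<le> 1 - 1/n; the power 6n gives
  exp(-12).\<close>

lemma power_one_minus_inverse_ge:
  assumes "n \<ge> 2" "k \<le> 6 * n"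
  shows "(1 - 1 / real n) ^ k \<ge> exp (- 12)"
proof -
  have "exp (- (2 / real n)) \<le> 1 / (1 + 2 / real n)"
    using exp_ge_add_one_self[of "2 / real n"] assms
    by (subst exp_minus, subst inverse_eq_divide, intro divide_left_mono) (auto intro!: mult_pos_pos add_pos_nonneg)
  also have "\<dots> \<le> 1 - 1 / real n" using assms by (simp add: field_simps)
  finally have 1: "exp (- (2 / real n)) \<le> 1 - 1 / real n" .
  have "exp (- 12) = exp (- (2 / real n)) ^ (6 * n)"
    using assms by (simp add: exp_of_nat_mult[symmetric] field_simps)
  also have "\<dots> \<le> (1 - 1 / real n) ^ (6 * n)" by (intro power_mono 1) simp
  also have "\<dots> \<le> (1 - 1 / real n) ^ k" using assms by (intro power_decreasing) auto
  finally show ?thesis .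
qed

text \<open>At least 3n/2 messages of each value are sent, so there are at least (n^2/2)^2 sets of
  two and two, and each of them is the exact inbox with probability at least exp(-12)/n^4.\<close>

lemma prob_balanced_ge:
  assumes n: "n \<ge> 2" and v: "v < n" and c: "\<And>b. n \<le> 4 * cnt n x b"
  shows "measure_pmf.expectation (targets n) (\<lambda>tgt. if card (received n x v tgt \<inter> msgs n x True) = 2 \<and>
     card (received n x v tgt \<inter> msgs n x False) = 2 then 1 else 0 :: real) \<ge> exp (- 12) / 4"
proof -
  let ?P = "msgs n x True \<union> msgs n x False"
  let ?f = "\<lambda>S. if card (S \<inter> msgs n x True) = 2 \<and> card (S \<inter> msgs n x False) = 2 then 1 else (0::real)"
  let ?A = "\<lambda>b. 6 * cnt n x b"
  let ?F = "{S. S \<subseteq> ?P \<and> card (S \<inter> msgs n x True) = 2 \<and> card (S - msgs n x True) = 2}"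
  have n0: "n > 0" using n by simp
  have diff: "S - msgs n x True = S \<inter> msgs n x False" if "S \<subseteq> ?P" for S
    using that msgs_disjoint[of n x True] by auto
  have c4: "card S = 4" if "S \<in> ?F" for S
  proof -
    have "finite S" using that by (auto intro: finite_subset)
    then show ?thesis using that card_Int_Diff[of S "msgs n x True"] by simp
  qed
  have "?P - msgs n x True = msgs n x False" using msgs_disjoint[of n x True] by auto
  then have cF: "card ?F = (?A True choose 2) * (?A False choose 2)"
    using card_subsets_by_part_cards[of ?P "msgs n x True" 2 2] by (simp add: card_msgs cnt_def)
  have ch: "real (?A b choose 2) \<ge> (real n)\<^sup>2 / 2" for b
  proof -
    have a: "real (?A b) \<ge> 3 / 2 * real n" using c[of b] by linarith
    have "(real n)\<^sup>2 / 2 \<le> (3 / 2 * real n) * (3 / 4 * real n) / 2" by (simp add: power2_eq_square)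
    also have "\<dots> \<le> real (?A b) * (real (?A b) - 1) / 2"
      using a n by (intro divide_right_mono mult_mono) auto
    finally show ?thesis unfolding real_choose_2 .
  qed
  have "measure_pmf.expectation (targets n) (\<lambda>tgt. ?f (received n x v tgt)) =
     (\<Sum>S\<in>Pow ?P. ?f S * ((1 / real n) ^ card S * (1 - 1 / real n) ^ (card ?P - card S)))"
    by (rule expectation_received[OF n0 v])
  also have "\<dots> = (\<Sum>S\<in>?F. (1 / real n) ^ card S * (1 - 1 / real n) ^ (card ?P - card S))"
    by (rule sum.mono_neutral_cong_right) (use n0 in \<open>auto simp: diff\<close>)
  also have "\<dots> = (\<Sum>S\<in>?F. (1 / real n) ^ 4 * (1 - 1 / real n) ^ (card ?P - 4))"
  proof (rule sum.cong[OF refl])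
    fix S assume "S \<in> ?F"
    from c4[OF this] show "(1 / real n) ^ card S * (1 - 1 / real n) ^ (card ?P - card S) = (1 / real n) ^ 4 * (1 - 1 / real n) ^ (card ?P - 4)"
      by simp
  qed
  also have "\<dots> = real (?A True choose 2) * real (?A False choose 2) * ((1 / real n) ^ 4 * (1 - 1 / real n) ^ (card ?P - 4))"
    using cF by simp
  also have "\<dots> \<ge> (real n)\<^sup>2 / 2 * ((real n)\<^sup>2 / 2) * ((1 / real n) ^ 4 * exp (- 12))"
  proof (rule mult_mono)
    have "card ?P - 4 \<le> 6 * n" unfolding card_all_msgs using cnt_add_le[of n x True] by simp
    then show "(1 / real n) ^ 4 * exp (- 12) \<le> (1 / real n) ^ 4 * (1 - 1 / real n) ^ (card ?P - 4)"
      using n by (intro mult_left_mono power_one_minus_inverse_ge) auto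
    show "(real n)\<^sup>2 / 2 * ((real n)\<^sup>2 / 2) \<le> real (?A True choose 2) * real (?A False choose 2)"
      by (intro mult_mono ch) auto
  qed auto
  also have "(real n)\<^sup>2 / 2 * ((real n)\<^sup>2 / 2) * ((1 / real n) ^ 4 * exp (- 12)) = exp (- 12) / 4"
    using n by (simp add: field_simps eval_nat_numeral)
  finally show ?thesis .
qed

text \<open>Markov's inequality in reverse: a count that never exceeds \<open>n\<close> and has mean
  at least \<open>\<kappa> / 5 * n\<close> is at least half of this with probability at least
  \<open>\<kappa> / 10\<close>. The mean uses 15/16 * 1/4 > 1/5.\<close>

lemma many_balanced_nodes:
  assumes n: "n \<ge> 2" and B: "B \<subseteq> {..<n}" "real (card B) \<le> real n / 16" and c: "\<And>b. n \<le> 4 * cnt n x b"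
  shows "measure_pmf.prob (targets n) {tgt. real (card (balanced_nodes n B x tgt)) \<ge> exp (- 12) / 10 * real n} \<ge> exp (- 12) / 10"
proof -
  have n0: "n > 0" using n by simp
  define \<kappa> :: real where "\<kappa> = exp (- 12)"
  note [simp] = integrable_measure_pmf_finite[OF finite_set_targets[OF n0]]
  let ?X = "\<lambda>tgt. real (card (balanced_nodes n B x tgt))"
  let ?A = "{tgt. ?X tgt \<ge> \<kappa> / 10 * real n}"
  let ?g = "\<lambda>v tgt. if card (received n x v tgt \<inter> msgs n x True) = 2 \<and>
     card (received n x v tgt \<inter> msgs n x False) = 2 then 1 else (0::real)"
  have X: "?X tgt = (\<Sum>v\<in>{..<n} - B. ?g v tgt)" for tgt
    unfolding balanced_nodes_def by (subst sum.inter_filter[symmetric]) auto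
  have cB: "real (card ({..<n} - B)) \<ge> 15 / 16 * real n"
    using B card_mono[OF _ B(1)] finite_subset[OF B(1)] by (simp add: card_Diff_subset of_nat_diff)
  have "\<kappa> / 5 * real n \<le> (15 / 16 * real n) * (\<kappa> / 4)" by (simp add: \<kappa>_def)
  also have "\<dots> \<le> real (card ({..<n} - B)) * (\<kappa> / 4)"
    using cB by (intro mult_right_mono) (auto simp: \<kappa>_def)
  also have "\<dots> = (\<Sum>v\<in>{..<n} - B. \<kappa> / 4)" by simp
  also have "\<dots> \<le> (\<Sum>v\<in>{..<n} - B. measure_pmf.expectation (targets n) (?g v))"
    unfolding \<kappa>_def by (intro sum_mono prob_balanced_ge n c) auto
  also have "\<dots> = measure_pmf.expectation (targets n) ?X"
    unfolding X by (subst Bochner_Integration.integral_sum) auto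
  also have "\<dots> \<le> measure_pmf.expectation (targets n) (\<lambda>tgt. \<kappa> / 10 * real n + real n * indicat_real ?A tgt)"
  proof (rule expectation_mono_finite[OF finite_set_targets[OF n0]])
    fix tgt
    have "card (balanced_nodes n B x tgt) \<le> card {..<n}" unfolding balanced_nodes_def by (rule card_mono) auto
    then have "?X tgt \<le> real n" by simp
    moreover have "0 \<le> \<kappa> / 10 * real n" by (simp add: \<kappa>_def)
    ultimately show "?X tgt \<le> \<kappa> / 10 * real n + real n * indicat_real ?A tgt"
      by (auto simp: indicator_def)
  qed
  also have "\<dots> = \<kappa> / 10 * real n + real n * measure_pmf.prob (targets n) ?A" by simp
  finally have "real n * (\<kappa> / 10) \<le> real n * measure_pmf.prob (targets n) ?A" by (simp add: field_simps)
  then show ?thesis using n unfolding \<kappa>_def by (simp only: mult_le_cancel_left_pos of_nat_0_less_iff n0)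
qed

lemma updates_anticoncentration:
  assumes Q: "real (card (balanced_nodes n B x tgt)) \<ge> c * real n" and J: "J > 0"
    and c: "c > 0" and n: "c * real n \<ge> 2 * real J"
  shows "measure_pmf.prob (updates n B x tgt) {x'. gap n x' \<ge> sqrt (real J * c * real n / 8)} \<ge> (3 / 32) ^ J"
proof -
  let ?Q = "balanced_nodes n B x tgt"
  \<comment> \<open>Cutting the balanced nodes down to a multiple of \<open>J\<close> discards fewer
    than \<open>J\<close> of them, at most half of \<open>c * n\<close>.\<close>
  define k where "k = card ?Q div J"
  have fQ: "finite ?Q" by (simp add: balanced_nodes_def)
  have "J * k \<le> card ?Q" unfolding k_def by simp
  then obtain Q' where Q': "Q' \<subseteq> ?Q" "card Q' = J * k" using fQ by (meson obtain_subset_with_card_n)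
  have "card ?Q = J * k + card ?Q mod J" unfolding k_def by simp
  moreover have "card ?Q mod J < J" using J by simp
  ultimately have "card ?Q \<le> J * k + J" by linarith
  then have "real (card ?Q) \<le> real (J * k + J)" by (rule of_nat_mono)
  then have k: "c * real n / 2 \<le> real J * real k" using Q n by simp
  have "sqrt (real J * c * real n / 8) = sqrt (real J * (c * real n / 2)) / 2"
  proof -
    have "real J * c * real n / 8 = real J * (c * real n / 2) / 4" by simp
    then show ?thesis by (simp only: real_sqrt_divide real_sqrt_four)
  qed
  also have "\<dots> \<le> sqrt (real J * (real J * real k)) / 2"
    using k by (intro divide_right_mono real_sqrt_le_mono mult_left_mono) auto
  also have "\<dots> = real J * (sqrt (real k) / 2)"
    by (simp add: real_sqrt_mult mult.assoc[symmetric])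
  finally have t: "sqrt (real J * c * real n / 8) \<le> real J * (sqrt (real k) / 2)" .
  have fair: "node_update 3 False (v \<in> B) (x v) (deliver n 6 x tgt v) = pmf_of_set {Some True, Some False}" if "v \<in> Q'" for v
  proof -
    have "v < n" "v \<notin> B" "card (received n x v tgt \<inter> msgs n x True) = 2" "card (received n x v tgt \<inter> msgs n x False) = 2"
      using that Q'(1) by (auto simp: balanced_nodes_def)
    then show ?thesis using node_update_two_two[of "deliver n 6 x tgt v" "x v"] by (simp add: count_deliver)
  qed
  have "(3 / 32) ^ J \<le> measure_pmf.prob (walk (J * k)) {r. real_of_int r \<ge> real J * (sqrt (real k) / 2)}"
    by (rule walk_block_anticoncentration)
  also have "\<dots> \<le> measure_pmf.prob (walk (card Q')) {r. real_of_int r \<ge> sqrt (real J * c * real n / 8)}"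
    unfolding Q'(2) by (rule measure_pmf.finite_measure_mono) (use t in auto)
  also have "\<dots> \<le> measure_pmf.prob (updates n B x tgt) {x'. \<bar>stat n (vote True) x'\<bar> \<ge> sqrt (real J * c * real n / 8)}"
    unfolding updates_def
    by (rule fair_votes_anticoncentration) (use Q' fair in \<open>auto simp: balanced_nodes_def finite_set_node_update\<close>)
  finally show ?thesis by (simp add: stat_vote gap_def)
qed

lemma gap_escape:
  fixes K :: real
  assumes K: "K > 0"
  obtains p n0 where "p > 0" "\<And>n B x. n \<ge> n0 \<Longrightarrow> B \<subseteq> {..<n} \<Longrightarrow> real (card B) \<le> real n / 16 \<Longrightarrow> mostly_defined n x \<Longrightarrow>
    gap n x \<le> K * sqrt (real n) \<Longrightarrow> measure_pmf.prob (step n B x) {x'. gap n x' \<ge> 2 * K * sqrt (real n)} \<ge> p"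
proof -
  define c :: real where "c = exp (- 12) / 10"
  have c: "c > 0" by (simp add: c_def)
  \<comment> \<open>This makes \<open>J * c / 8\<close> at least \<open>4 * K\<^sup>2\<close>, so
    that the deviation \<open>sqrt (J * c * n / 8)\<close> reaches
    \<open>2 * K * sqrt n\<close>.\<close>
  define J where "J = nat \<lceil>32 * K\<^sup>2 / c\<rceil>"
  have "32 * K\<^sup>2 / c > 0" using K c by simp
  then have J: "J > 0" "real J \<ge> 32 * K\<^sup>2 / c" unfolding J_def by linarith+
  \<comment> \<open>The first bound absorbs the rounding to blocks. The second gives K sqrt n \<le>
    n/6, so that either value is held by at least (2n/3 - n/6)/2 = n/4 nodes.\<close>
  define n0 where "n0 = nat \<lceil>max (2 * real J / c) (max (36 * K\<^sup>2) 2)\<rceil>"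
  have main: "measure_pmf.prob (step n B x) {x'. gap n x' \<ge> 2 * K * sqrt (real n)} \<ge> c * (3 / 32) ^ J"
    if n: "n \<ge> n0" and B: "B \<subseteq> {..<n}" "real (card B) \<le> real n / 16" and x: "mostly_defined n x"
      and g: "gap n x \<le> K * sqrt (real n)" for n B x
  proof -
    have "real n \<ge> max (2 * real J / c) (max (36 * K\<^sup>2) 2)"
      using n unfolding n0_def by linarith
    then have n': "real n \<ge> 2 * real J / c" "real n \<ge> 36 * K\<^sup>2" "n \<ge> 2" by auto
    have nc: "c * real n \<ge> 2 * real J" using n'(1) c by (simp add: field_simps)
    have n0': "n > 0" using n' by simp
    have "6 * K = sqrt (36 * K\<^sup>2)" using K by (simp add: real_sqrt_mult)
    also have "\<dots> \<le> sqrt (real n)" using n' by simp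
    finally have "(6 * K) * sqrt (real n) \<le> sqrt (real n) * sqrt (real n)" by (intro mult_right_mono) auto
    then have "K * sqrt (real n) \<le> real n / 6" by simp
    then have "gap n x \<le> real n / 6" using g by linarith
    moreover have "real (2 * n) \<le> real (3 * (cnt n x True + cnt n x False))"
      using x unfolding mostly_defined_def by (rule of_nat_mono)
    then have "2 * real n \<le> 3 * (real (cnt n x True) + real (cnt n x False))" by simp
    moreover have "real (cnt n x True) - real (cnt n x False) \<le> gap n x" "real (cnt n x False) - real (cnt n x True) \<le> gap n x"
      by (auto simp: gap_def)
    moreover have "m \<le> 4 * a" if "h \<le> m / 6" "2 * m \<le> 3 * (a + b)" "b - a \<le> h" for a b h m :: real
      using that by argo
    ultimately have "real n \<le> 4 * real (cnt n x True)" "real n \<le> 4 * real (cnt n x False)"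
      by (simp_all add: add.commute)
    then have cn: "n \<le> 4 * cnt n x b" for b by (cases b) simp_all
    have "4 * K\<^sup>2 \<le> real J * c / 8" using J(2) c by (simp add: field_simps)
    then have "(4 * K\<^sup>2) * real n \<le> (real J * c / 8) * real n" by (intro mult_right_mono) auto
    then have "sqrt ((4 * K\<^sup>2) * real n) \<le> sqrt (real J * c * real n / 8)" by simp
    moreover have "sqrt ((4 * K\<^sup>2) * real n) = 2 * K * sqrt (real n)" using K by (simp add: real_sqrt_mult)
    ultimately have t: "2 * K * sqrt (real n) \<le> sqrt (real J * c * real n / 8)" by simp
    let ?E = "{x'. gap n x' \<ge> 2 * K * sqrt (real n)}"
    let ?A = "{tgt. real (card (balanced_nodes n B x tgt)) \<ge> c * real n}"
    note [simp] = integrable_measure_pmf_finite[OF finite_set_targets[OF n0']]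
    have "c * (3 / 32) ^ J \<le> measure_pmf.prob (targets n) ?A * (3 / 32) ^ J"
      using many_balanced_nodes[OF n'(3) B, of x] cn by (intro mult_right_mono) (auto simp: c_def)
    also have "\<dots> = measure_pmf.expectation (targets n) (\<lambda>tgt. indicat_real ?A tgt * (3 / 32) ^ J)" by simp
    also have "\<dots> \<le> measure_pmf.expectation (targets n) (\<lambda>tgt. measure_pmf.expectation (updates n B x tgt) (indicat_real ?E))"
    proof (rule expectation_mono_finite[OF finite_set_targets[OF n0']])
      fix tgt
      show "indicat_real ?A tgt * (3 / 32) ^ J \<le> measure_pmf.expectation (updates n B x tgt) (indicat_real ?E)"
      proof (cases "tgt \<in> ?A")
        case True
        then have "(3 / 32) ^ J \<le> measure_pmf.prob (updates n B x tgt) {x'. gap n x' \<ge> sqrt (real J * c * real n / 8)}"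
          by (intro updates_anticoncentration J c nc) simp
        also have "\<dots> \<le> measure_pmf.prob (updates n B x tgt) ?E"
          by (rule measure_pmf.finite_measure_mono) (use t in auto)
        finally show ?thesis using True by simp
      qed simp
    qed
    also have "\<dots> = measure_pmf.expectation (step n B x) (indicat_real ?E)"
      by (rule expectation_step[OF n0', symmetric])
    finally show ?thesis by simp
  qed
  show ?thesis by (rule that[of "c * (3 / 32) ^ J" n0]) (use c main in auto)
qed

section \<open>Lyapunov function and the full process\<close>

definition potential :: "nat \<Rightarrow> (nat \<Rightarrow> bool option) \<Rightarrow> real" where
  "potential n x = 10000 * sqrt (real n) / max (10000 * sqrt (real n)) (gap n x)"

lemma potential_bounds:
  assumes "n > 0"
  shows "0 \<le> potential n x" "potential n x \<le> 1"
  using assms by (auto simp: potential_def divide_le_eq_1 le_max_iff_disj intro!: divide_nonneg_nonneg less_max_iff_disj[THEN iffD2])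

lemma potential_le:
  assumes "n > 0" "0 < s" "s \<le> gap n x"
  shows "potential n x \<le> 10000 * sqrt (real n) / s"
  using assms unfolding potential_def by (intro divide_left_mono) (auto intro!: mult_pos_pos simp: less_max_iff_disj)

text \<open>With V the current potential, a successful round leaves at most 20/21 V, and a failed
  one leaves at most 1. Chebyshev's bound on the failure probability is quadratic in V, hence at
  most a constant times V; the threshold 10000 sqrt n makes this constant 0.00232, small enough for
  the total factor 0.97.\<close>

lemma potential_drift_large_gap:
  assumes n: "n \<ge> 200" and B: "B \<subseteq> {..<n}" "real (card B) \<le> real n / 16" and x: "mostly_defined n x"
    and g: "gap n x \<ge> 10000 * sqrt (real n)" "gap n x \<le> 36 / 100 * real n"
  shows "measure_pmf.expectation (step n B x) (potential n) \<le> 97 / 100 * potential n x"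
proof -
  have n0: "n > 0" using n by simp
  note [simp] = integrable_measure_pmf_finite[OF finite_set_step[OF n0]]
  define k where "k = 10000 * sqrt (real n)"
  define y where "y = gap n x"
  have k: "k > 0" using n0 by (simp add: k_def)
  have y: "y \<ge> k" "y > 0" using g k unfolding k_def y_def by linarith+
  have V: "potential n x = k / y" using y by (simp add: potential_def k_def y_def max_def)
  let ?E = "{x'. gap n x' < 21 / 20 * y}"
  have "measure_pmf.expectation (step n B x) (potential n) \<le>
     measure_pmf.expectation (step n B x) (\<lambda>x'. 20 / 21 * (k / y) + indicat_real ?E x')"
  proof (rule expectation_mono_finite[OF finite_set_step[OF n0]])
    fix x'
    show "potential n x' \<le> 20 / 21 * (k / y) + indicat_real ?E x'"
    proof (cases "x' \<in> ?E")
      case True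
      then show ?thesis using potential_bounds(2)[OF n0, of x'] k y by (simp add: add_increasing)
    next
      case False
      then show ?thesis using potential_le[OF n0, of "21 / 20 * y" x'] y by (simp add: k_def)
    qed
  qed
  also have "\<dots> = 20 / 21 * (k / y) + measure_pmf.prob (step n B x) ?E" by simp
  also have "measure_pmf.prob (step n B x) ?E \<le> 232000 * real n / y\<^sup>2"
    unfolding y_def by (rule gap_growth[OF n B x]) (use y g in \<open>auto simp: y_def\<close>)
  also have "232000 * real n / y\<^sup>2 = 232 / 100000 * (k / y)\<^sup>2"
    by (simp add: k_def power_divide power_mult_distrib)
  also have "(k / y)\<^sup>2 \<le> k / y"
    using k y mult_left_le[of "k / y" "k / y"] unfolding power2_eq_square by simp
  finally have "measure_pmf.expectation (step n B x) (potential n) \<le> 20 / 21 * (k / y) + 232 / 100000 * (k / y)" by simp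
  also have "\<dots> = (20 / 21 + 232 / 100000) * (k / y)" by (rule distrib_right[symmetric])
  also have "\<dots> \<le> 97 / 100 * (k / y)" using k y by (intro mult_right_mono) auto
  finally show ?thesis unfolding V .
qed

lemma potential_drift:
  obtains \<rho> n0 where "0 < \<rho>" "\<rho> < 1"
    "\<And>n B x. n \<ge> n0 \<Longrightarrow> B \<subseteq> {..<n} \<Longrightarrow> real (card B) \<le> real n / 16 \<Longrightarrow> mostly_defined n x \<Longrightarrow>
      gap n x \<le> 36 / 100 * real n \<Longrightarrow> measure_pmf.expectation (step n B x) (potential n) \<le> \<rho> * potential n x"
proof -
  obtain p n1 where p: "p > 0" and escape: "\<And>n B x. n \<ge> n1 \<Longrightarrow> B \<subseteq> {..<n} \<Longrightarrow> real (card B) \<le> real n / 16 \<Longrightarrow> mostly_defined n x \<Longrightarrow>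
    gap n x \<le> 10000 * sqrt (real n) \<Longrightarrow> measure_pmf.prob (step n B x) {x'. gap n x' \<ge> 2 * 10000 * sqrt (real n)} \<ge> p"
    using gap_escape[of 10000] by auto
  \<comment> \<open>Below the threshold the potential is 1 and is halved with probability at least
    \<open>p\<close>, which accounts for \<open>1 - p / 2\<close>.\<close>
  define \<rho> where "\<rho> = max (97 / 100) (1 - p / 2)"
  show ?thesis
  proof (rule that[of \<rho> "max 200 n1"])
    show "0 < \<rho>" "\<rho> < 1" using p by (auto simp: \<rho>_def)
  next
    fix n B x
    assume n: "n \<ge> max 200 n1" and B: "B \<subseteq> {..<n}" "real (card B) \<le> real n / 16" and x: "mostly_defined n x"
      and g: "gap n x \<le> 36 / 100 * real n"
    have n0: "n > 0" using n by simp
    note [simp] = integrable_measure_pmf_finite[OF finite_set_step[OF n0]]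
    have V0: "potential n x \<ge> 0" by (rule potential_bounds[OF n0])
    show "measure_pmf.expectation (step n B x) (potential n) \<le> \<rho> * potential n x"
    proof (cases "gap n x \<ge> 10000 * sqrt (real n)")
      case True
      have "measure_pmf.expectation (step n B x) (potential n) \<le> 97 / 100 * potential n x"
        by (rule potential_drift_large_gap) (use n B x True g in auto)
      also have "\<dots> \<le> \<rho> * potential n x" using V0 by (intro mult_right_mono) (auto simp: \<rho>_def)
      finally show ?thesis .
    next
      case False
      let ?E = "{x'. gap n x' \<ge> 2 * 10000 * sqrt (real n)}"
      have V1: "potential n x = 1" using False n0 by (simp add: potential_def max_def)
      have "measure_pmf.expectation (step n B x) (potential n) \<le>
        measure_pmf.expectation (step n B x) (\<lambda>x'. 1 - 1 / 2 * indicat_real ?E x')"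
      proof (rule expectation_mono_finite[OF finite_set_step[OF n0]])
        fix x'
        show "potential n x' \<le> 1 - 1 / 2 * indicat_real ?E x'"
        proof (cases "x' \<in> ?E")
          case True
          then show ?thesis using potential_le[OF n0, of "2 * 10000 * sqrt (real n)" x'] n0 by simp
        next
          case False
          then show ?thesis using potential_bounds(2)[OF n0, of x'] by simp
        qed
      qed
      also have "\<dots> = 1 - 1 / 2 * measure_pmf.prob (step n B x) ?E" by simp
      also have "\<dots> \<le> 1 - p / 2" using escape[of n B x] n B x False by simp
      also have "\<dots> \<le> \<rho> * potential n x" unfolding V1 by (simp add: \<rho>_def)
      finally show ?thesis .
    qed
  qed
qed

section \<open>From one-round drift to the failure probability\<close>

definition decided :: "nat \<Rightarrow> (nat \<Rightarrow> bool option) \<Rightarrow> bool" where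
  "decided n x \<longleftrightarrow> mostly_defined n x \<and> gap n x \<ge> 36 / 100 * real n"

text \<open>Growth is applied with y = 0.36n even if the gap is larger; it then ends above 21/20 of
  the threshold unless a deviation linear in \<open>n\<close> occurs.\<close>

lemma decided_step:
  assumes n: "n \<ge> 200" and B: "B \<subseteq> {..<n}" "real (card B) \<le> real n / 16" and x: "decided n x"
  shows "measure_pmf.prob (step n B x) {x'. \<not> decided n x'} \<le> 3000000 / real n"
proof -
  have x': "mostly_defined n x" "gap n x \<ge> 36 / 100 * real n" using x by (auto simp: decided_def)
  let ?A = "{x'. \<not> mostly_defined n x'}" and ?E = "{x'. gap n x' < 21 / 20 * (36 / 100 * real n)}"
  have "measure_pmf.prob (step n B x) {x'. \<not> decided n x'} \<le> measure_pmf.prob (step n B x) (?A \<union> ?E)"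
    by (rule measure_pmf.finite_measure_mono) (auto simp: decided_def)
  also have "\<dots> \<le> measure_pmf.prob (step n B x) ?A + measure_pmf.prob (step n B x) ?E"
    by (rule measure_Un_le) auto
  also have "\<dots> \<le> 500000 / real n + 232000 * real n / (36 / 100 * real n)\<^sup>2"
    by (rule add_mono[OF mostly_defined_step[OF n B x'(1)] gap_growth[OF n B x'(1)]]) (use n x' in auto)
  also have "\<dots> \<le> 3000000 / real n"
    using n by (simp add: field_simps power2_eq_square)
  finally show ?thesis .
qed

text \<open>A supermartingale-type bound on the probability of being undecided \<open>j\<close> rounds later; the
  second summand accounts for the rounds that leave the region where the drift estimates hold.\<close>

definition failure_bound :: "real \<Rightarrow> nat \<Rightarrow> nat \<Rightarrow> (nat \<Rightarrow> bool option) \<Rightarrow> real" where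
  "failure_bound \<rho> n j x = (if mostly_defined n x then
     min 1 ((if decided n x then 0 else \<rho> ^ j * sqrt (real n) * potential n x) + real j * (3000000 / real n)) else 1)"

text \<open>From a decided vector, becoming undecided costs at most 1 and has probability at most
  3000000/n, which is the increase of the second summand. From an undecided but mostly defined one,
  the contraction of the potential supplies the extra factor \<rho>, and losing too many defined
  nodes is paid for by the same increase.\<close>

lemma failure_bound_step:
  assumes n: "n \<ge> 200" and B: "B \<subseteq> {..<n}" "real (card B) \<le> real n / 16" and \<rho>: "0 < \<rho>"
    and drift: "mostly_defined n x \<Longrightarrow> gap n x \<le> 36 / 100 * real n \<Longrightarrow>
      measure_pmf.expectation (step n B x) (potential n) \<le> \<rho> * potential n x"
  shows "measure_pmf.expectation (step n B x) (failure_bound \<rho> n j) \<le> failure_bound \<rho> n (Suc j) x"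
proof -
  have n0: "n > 0" using n by simp
  have fin: "finite (set_pmf (step n B x))" by (rule finite_set_step[OF n0])
  note [simp] = integrable_measure_pmf_finite[OF fin]
  let ?E = "measure_pmf.expectation (step n B x)"
  define e where "e = 3000000 / real n"
  have e: "e \<ge> 0" by (simp add: e_def)
  have F1: "failure_bound \<rho> n j x' \<le> 1" for x' by (simp add: failure_bound_def)
  have le1: "?E (failure_bound \<rho> n j) \<le> 1" by (rule expectation_le_const[OF fin F1])
  consider "\<not> mostly_defined n x" | "decided n x" | "mostly_defined n x" "\<not> decided n x" by blast
  then show ?thesis
  proof cases
    case 1
    then show ?thesis using le1 by (simp add: failure_bound_def)
  next
    case 2
    let ?A = "{x'. \<not> decided n x'}"
    have "?E (failure_bound \<rho> n j) \<le> ?E (\<lambda>x'. indicat_real ?A x' + real j * e)"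
    proof (rule expectation_mono_finite[OF fin])
      fix x'
      show "failure_bound \<rho> n j x' \<le> indicat_real ?A x' + real j * e"
      proof (cases "decided n x'")
        case True
        then show ?thesis by (simp add: failure_bound_def decided_def e_def)
      next
        case False
        then show ?thesis using F1[of x'] e by (simp add: add_increasing2)
      qed
    qed
    also have "\<dots> = measure_pmf.prob (step n B x) ?A + real j * e" by simp
    also have "\<dots> \<le> e + real j * e" using decided_step[OF n B 2] by (simp add: e_def)
    finally have "?E (failure_bound \<rho> n j) \<le> real (Suc j) * e" by (simp add: algebra_simps)
    moreover have "mostly_defined n x" using 2 by (simp add: decided_def)
    ultimately show ?thesis using le1 2 by (simp add: failure_bound_def e_def)
  next
    case 3
    let ?A = "{x'. \<not> mostly_defined n x'}"
    let ?r = "\<rho> ^ j * sqrt (real n)"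
    have r: "?r \<ge> 0" using \<rho> by simp
    have "?E (failure_bound \<rho> n j) \<le> ?E (\<lambda>x'. indicat_real ?A x' + ?r * potential n x' + real j * e)"
    proof (rule expectation_mono_finite[OF fin])
      fix x'
      have V: "?r * potential n x' \<ge> 0" using r potential_bounds(1)[OF n0] by (rule mult_nonneg_nonneg)
      show "failure_bound \<rho> n j x' \<le> indicat_real ?A x' + ?r * potential n x' + real j * e"
      proof (cases "mostly_defined n x'")
        case True
        then show ?thesis using V by (simp add: failure_bound_def e_def min_le_iff_disj)
      next
        case False
        then show ?thesis using F1[of x'] V e by (simp add: add_increasing2)
      qed
    qed
    also have "\<dots> = measure_pmf.prob (step n B x) ?A + ?r * ?E (potential n) + real j * e" by simp
    also have "\<dots> \<le> e + ?r * (\<rho> * potential n x) + real j * e"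
    proof -
      have "measure_pmf.prob (step n B x) ?A \<le> 500000 / real n" by (rule mostly_defined_step[OF n B 3(1)])
      also have "\<dots> \<le> e" unfolding e_def by (intro divide_right_mono) auto
      finally have "measure_pmf.prob (step n B x) ?A \<le> e" .
      moreover have "?r * ?E (potential n) \<le> ?r * (\<rho> * potential n x)"
        by (intro mult_left_mono r drift) (use 3 in \<open>auto simp: decided_def\<close>)
      ultimately show ?thesis by linarith
    qed
    finally have "?E (failure_bound \<rho> n j) \<le> \<rho> ^ Suc j * sqrt (real n) * potential n x + real (Suc j) * e"
      by (simp add: algebra_simps)
    then show ?thesis using le1 3 by (simp add: failure_bound_def e_def)
  qed
qed

lemma gap_le: "gap n x \<le> real n"
proof -
  have "real (cnt n x True + cnt n x False) \<le> real n" using cnt_add_le[of n x True] by (simp only: of_nat_le_iff simp_thms)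
  then show ?thesis unfolding gap_def by simp
qed

text \<open>The factor \<open>sqrt n\<close> is the normalisation that makes this work: a gap never
  exceeds \<open>n\<close>, so the potential is at least 1 / sqrt n and an undecided vector has
  failure bound 1.\<close>

lemma failure_bound_0:
  assumes "n > 0"
  shows "indicator {x. \<not> decided n x} x \<le> failure_bound \<rho> n 0 x"
proof -
  have "sqrt (real n) * potential n x \<ge> 1"
  proof -
    have "max (10000 * sqrt (real n)) (gap n x) \<le> 10000 * real n"
    proof (rule max.boundedI)
      have "sqrt (real n) * 1 \<le> sqrt (real n) * sqrt (real n)" using assms by (intro mult_left_mono) auto
      then show "10000 * sqrt (real n) \<le> 10000 * real n" by simp
      show "gap n x \<le> 10000 * real n" using gap_le[of n x] by simp
    qed
    moreover have "max (10000 * sqrt (real n)) (gap n x) > 0" using assms by (simp add: less_max_iff_disj)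
    ultimately have "1 \<le> 10000 * real n / max (10000 * sqrt (real n)) (gap n x)" by simp
    also have "10000 * real n = sqrt (real n) * (10000 * sqrt (real n))" by simp
    finally show ?thesis by (simp only: potential_def times_divide_eq_right)
  qed
  then show ?thesis by (auto simp: failure_bound_def indicator_def decided_def)
qed

text \<open>Stops halfway through round \<open>t + 1\<close>, after the values are updated and
  before the targets are drawn. The recorded history is then exactly what the adversary sees when it
  chooses the blocked set of round \<open>t + 2\<close>.\<close>

definition values_run :: "nat \<Rightarrow> adversary \<Rightarrow> config \<Rightarrow> nat \<Rightarrow> (config list \<times> (nat \<Rightarrow> bool option)) pmf" where
  "values_run n adv S1 t = do {
     h \<leftarrow> run n 6 3 adv S1 t;
     x' \<leftarrow> Pi_pmf {..<n} None (\<lambda>u. node_update 3 (t = 0) (u \<in> adv (Suc t) (adv_view (Suc t) h)) (fst (last h) u) (snd (last h) u));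
     return_pmf (h, x') }"

lemma run_Suc_values_run:
  "run n 6 3 adv S1 (Suc t) = do { (h, x) \<leftarrow> values_run n adv S1 t; tgt \<leftarrow> targets n; return_pmf (h @ [(x, deliver n 6 x tgt)]) }"
  by (simp add: values_run_def round_step_def targets_def bind_assoc_pmf bind_return_pmf)

text \<open>The adversary of the next round does not see the last configuration, so the targets drawn in
  the current round are independent of the set of nodes that it blocks.\<close>

lemma values_run_Suc:
  "values_run n adv S1 (Suc t) = do {
     (h, x) \<leftarrow> values_run n adv S1 t;
     tgt \<leftarrow> targets n;
     x' \<leftarrow> updates n (adv (Suc (Suc t)) h) x tgt;
     return_pmf (h @ [(x, deliver n 6 x tgt)], x') }"
  by (subst values_run_def, subst run_Suc_values_run)
    (simp add: bind_assoc_pmf bind_return_pmf updates_def adv_view_def split_def)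

lemma finite_set_run: "n > 0 \<Longrightarrow> finite (set_pmf (run n 6 3 adv S1 t))"
proof (induction t)
  case (Suc t)
  have "finite (set_pmf (round_step n 6 3 f B c))" for f B c
    unfolding round_step_def using finite_set_targets[OF Suc.prems]
    by (auto simp: targets_def intro!: finite_set_pmf_Pi_pmf finite_set_node_update)
  then show ?case using Suc by auto
qed simp

lemma finite_set_values_run: "n > 0 \<Longrightarrow> finite (set_pmf (values_run n adv S1 t))"
  unfolding values_run_def
  by (auto intro!: finite_set_run finite_set_pmf_Pi_pmf finite_set_node_update)

lemma expectation_values_run_Suc:
  fixes f :: "(nat \<Rightarrow> bool option) \<Rightarrow> real"
  assumes n: "n > 0"
  shows "measure_pmf.expectation (values_run n adv S1 (Suc t)) (\<lambda>hx. f (snd hx)) =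
    measure_pmf.expectation (values_run n adv S1 t) (\<lambda>hx. measure_pmf.expectation (step n (adv (Suc (Suc t)) (fst hx)) (snd hx)) f)"
  unfolding values_run_Suc split_def
  by (simp add: expectation_bind_pmf_finite finite_set_values_run finite_set_targets finite_set_updates n expectation_step)

lemma expectation_values_run_failure_bound:
  assumes n: "n \<ge> 200" and \<rho>: "0 < \<rho>" and adv: "\<And>t h. adv t h \<subseteq> {..<n}" "\<And>t h. real (card (adv t h)) \<le> real n / 16"
    and drift: "\<And>B x. B \<subseteq> {..<n} \<Longrightarrow> real (card B) \<le> real n / 16 \<Longrightarrow> mostly_defined n x \<Longrightarrow> gap n x \<le> 36 / 100 * real n \<Longrightarrow>
      measure_pmf.expectation (step n B x) (potential n) \<le> \<rho> * potential n x"
  shows "measure_pmf.expectation (values_run n adv S1 t) (\<lambda>hx. failure_bound \<rho> n j (snd hx)) \<le>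
    measure_pmf.expectation (values_run n adv S1 0) (\<lambda>hx. failure_bound \<rho> n (t + j) (snd hx))"
proof (induction t arbitrary: j)
  case (Suc t)
  have n0: "n > 0" using n by simp
  have "measure_pmf.expectation (values_run n adv S1 (Suc t)) (\<lambda>hx. failure_bound \<rho> n j (snd hx)) \<le>
    measure_pmf.expectation (values_run n adv S1 t) (\<lambda>hx. failure_bound \<rho> n (Suc j) (snd hx))"
    unfolding expectation_values_run_Suc[OF n0]
    by (intro expectation_mono_finite finite_set_values_run n0 failure_bound_step n adv \<rho> drift)
  also have "\<dots> \<le> measure_pmf.expectation (values_run n adv S1 0) (\<lambda>hx. failure_bound \<rho> n (t + Suc j) (snd hx))"
    by (rule Suc.IH)
  finally show ?case by simp
qed simp

text \<open>Round 1 is not a \<open>step\<close>: unblocked nodes keep their initial values, so at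
  least 15n/16 nodes are defined when the chain starts.\<close>

lemma values_run_0:
  assumes hx: "hx \<in> set_pmf (values_run n adv (init_config n x0) 0)"
    and adv: "adv 1 [init_config n x0] \<subseteq> {..<n}" "real (card (adv 1 [init_config n x0])) \<le> real n / 16"
  shows "mostly_defined n (snd hx)"
proof -
  let ?B = "adv 1 [init_config n x0]"
  have fB: "finite ?B" using adv(1) finite_subset by blast
  have "snd hx u = Some (x0 u)" if "u \<in> {..<n} - ?B" for u
  proof -
    have "snd hx \<in> PiE_dflt {..<n} None (\<lambda>u. set_pmf (node_update 3 True (u \<in> ?B) (fst (init_config n x0) u) (snd (init_config n x0) u)))"
      using hx unfolding values_run_def by (auto simp: adv_view_def set_Pi_pmf bind_return_pmf o_def)
    then have "snd hx u \<in> set_pmf (node_update 3 True (u \<in> ?B) (fst (init_config n x0) u) (snd (init_config n x0) u))"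
      using that by (auto simp: PiE_dflt_def)
    then show ?thesis using that by (simp add: node_update_def init_config_def)
  qed
  then have "snd hx u = Some True \<or> snd hx u = Some False" if "u \<in> {..<n} - ?B" for u
    using that by (cases "x0 u") auto
  then have "{..<n} - ?B \<subseteq> {u\<in>{..<n}. snd hx u = Some True} \<union> {u\<in>{..<n}. snd hx u = Some False}"
    by auto
  then have "card ({..<n} - ?B) \<le> card ({u\<in>{..<n}. snd hx u = Some True} \<union> {u\<in>{..<n}. snd hx u = Some False})"
    by (intro card_mono) auto
  also have "\<dots> \<le> cnt n (snd hx) True + cnt n (snd hx) False"
    unfolding cnt_def by (rule card_Un_le)
  finally have "card ({..<n} - ?B) \<le> cnt n (snd hx) True + cnt n (snd hx) False" .
  then have "n \<le> cnt n (snd hx) True + cnt n (snd hx) False + card ?B"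
    using fB adv(1) by (simp add: card_Diff_subset)
  then have "real n \<le> real (cnt n (snd hx) True + cnt n (snd hx) False) + real (card ?B)"
    by (metis of_nat_add of_nat_le_iff)
  then have "real (2 * n) \<le> real (3 * (cnt n (snd hx) True + cnt n (snd hx) False))"
    using adv(2) by simp
  then show ?thesis unfolding mostly_defined_def by (simp only: of_nat_le_iff)
qed

text \<open>The larger count is half the sum of defined nodes and gap, at least (2/3 + 0.36)/2 >
  0.51 of all nodes.\<close>

lemma decided_majority:
  assumes "decided n x"
  shows "\<exists>b. real (card {u\<in>{..<n}. x u = Some b}) \<ge> (1 - 49 / 100) * real n"
proof -
  have "real (2 * n) \<le> real (3 * (cnt n x True + cnt n x False))"
    using assms unfolding decided_def mostly_defined_def by (simp only: of_nat_le_iff)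
  then have "2 * real n \<le> 3 * (real (cnt n x True) + real (cnt n x False))" by simp
  moreover have "gap n x \<ge> 36 / 100 * real n" using assms by (simp add: decided_def)
  ultimately have "real (cnt n x True) \<ge> (1 - 49 / 100) * real n \<or> real (cnt n x False) \<ge> (1 - 49 / 100) * real n"
    unfolding gap_def by (simp add: abs_if split: if_splits)
  then show ?thesis unfolding cnt_def by blast
qed

text \<open>Round 1 only sets up the chain, so \<open>Suc t\<close> rounds contain \<open>t\<close>
  steps. The initial potential is bounded by 1, whatever the initial values are.\<close>

lemma prob_run_undecided:
  assumes n: "n \<ge> 200" and \<rho>: "0 < \<rho>" and adv: "\<And>t h. adv t h \<subseteq> {..<n}" "\<And>t h. real (card (adv t h)) \<le> real n / 16"
    and drift: "\<And>B x. B \<subseteq> {..<n} \<Longrightarrow> real (card B) \<le> real n / 16 \<Longrightarrow> mostly_defined n x \<Longrightarrow> gap n x \<le> 36 / 100 * real n \<Longrightarrow>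
      measure_pmf.expectation (step n B x) (potential n) \<le> \<rho> * potential n x"
  shows "measure_pmf.prob (run n 6 3 adv (init_config n x0) (Suc t)) {h. \<not> decided n (fst (last h))} \<le>
    \<rho> ^ t * sqrt (real n) + real t * (3000000 / real n)"
proof -
  have n0: "n > 0" using n by simp
  let ?S = "init_config n x0"
  have E: "measure_pmf.expectation (run n 6 3 adv ?S (Suc t)) (\<lambda>h. f (fst (last h))) =
      measure_pmf.expectation (values_run n adv ?S t) (\<lambda>hx. f (snd hx))" for f :: "_ \<Rightarrow> real"
    unfolding run_Suc_values_run split_def
    by (simp add: expectation_bind_pmf_finite finite_set_values_run finite_set_targets n0)
  have "measure_pmf.prob (run n 6 3 adv ?S (Suc t)) {h. \<not> decided n (fst (last h))} =
    measure_pmf.expectation (run n 6 3 adv ?S (Suc t)) (indicat_real {h. \<not> decided n (fst (last h))})" by simp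
  also have "\<dots> = measure_pmf.expectation (run n 6 3 adv ?S (Suc t)) (\<lambda>h. indicat_real {x. \<not> decided n x} (fst (last h)))"
    by (rule arg_cong[where f="measure_pmf.expectation _"]) (simp add: indicator_def fun_eq_iff)
  also have "\<dots> = measure_pmf.expectation (values_run n adv ?S t) (\<lambda>hx. indicat_real {x. \<not> decided n x} (snd hx))"
    by (rule E)
  also have "\<dots> \<le> measure_pmf.expectation (values_run n adv ?S t) (\<lambda>hx. failure_bound \<rho> n 0 (snd hx))"
    by (intro expectation_mono_finite finite_set_values_run n0 failure_bound_0)
  also have "\<dots> \<le> measure_pmf.expectation (values_run n adv ?S 0) (\<lambda>hx. failure_bound \<rho> n t (snd hx))"
    using expectation_values_run_failure_bound[OF n \<rho> adv drift, where ?S1.0 = ?S and t = t and j = 0] by simp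
  also have "\<dots> \<le> \<rho> ^ t * sqrt (real n) + real t * (3000000 / real n)"
  proof (rule expectation_le_const[OF finite_set_values_run[OF n0]])
    fix hx assume "hx \<in> set_pmf (values_run n adv ?S 0)"
    then have m: "mostly_defined n (snd hx)" by (rule values_run_0) (use adv in auto)
    have "\<rho> ^ t * sqrt (real n) * potential n (snd hx) \<le> \<rho> ^ t * sqrt (real n) * 1"
      using potential_bounds[OF n0] \<rho> by (intro mult_left_mono) auto
    moreover have "0 \<le> \<rho> ^ t * sqrt (real n)" using \<rho> by simp
    ultimately show "failure_bound \<rho> n t (snd hx) \<le> \<rho> ^ t * sqrt (real n) + real t * (3000000 / real n)"
      using m by (auto simp: failure_bound_def min_le_iff_disj)
  qed
  finally show ?thesis .
qed

theorem theorem1: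
  fixes \<epsilon> :: real
  assumes "0 \<le> \<epsilon>" and "\<epsilon> \<le> 1/16"
  shows "\<exists>C \<delta> c n0. C > 0 \<and> 0 \<le> \<delta> \<and> \<delta> < 1/2 \<and> c > 0 \<and>
    (\<forall>n \<ge> n0. \<exists>T::nat. real T \<le> C * ln (real n) \<and>
      (\<forall>(x0 :: nat \<Rightarrow> bool) (adv :: adversary). eps_bounded n \<epsilon> adv \<longrightarrow>
         measure_pmf.prob (run n 6 3 adv (init_config n x0) T)
           {h. \<exists>b. real (card {u\<in>{..<n}. fst (last h) u = Some b}) \<ge> (1 - \<delta>) * real n}
         \<ge> 1 - real n powr (- c)))"
proof -
  obtain \<rho> n1 where \<rho>: "0 < \<rho>" "\<rho> < 1" and drift:
    "\<And>n B x. n \<ge> n1 \<Longrightarrow> B \<subseteq> {..<n} \<Longrightarrow> real (card B) \<le> real n / 16 \<Longrightarrow> mostly_defined n x \<Longrightarrow>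
      gap n x \<le> 36 / 100 * real n \<Longrightarrow> measure_pmf.expectation (step n B x) (potential n) \<le> \<rho> * potential n x"
    using potential_drift by blast
  define L where "L = - ln \<rho>"
  have L: "L > 0" using \<rho> by (simp add: L_def)
  \<comment> \<open>The summand 2 covers rounding \<open>t\<close> up and the additional first
    round, each at most ln n for large \<open>n\<close>.\<close>
  define C where "C = 1 / L + 2"
  have C: "C > 0" using L by (simp add: C_def add_pos_pos)
  have "eventually (\<lambda>n::nat. real n powr (- 1 / 2) + C * ln (real n) * (3000000 / real n) \<le> real n powr (- 1 / 4)) sequentially"
    using C by real_asymp
  then obtain n2 where n2: "\<And>n. n \<ge> n2 \<Longrightarrow> real n powr (- 1 / 2) + C * ln (real n) * (3000000 / real n) \<le> real n powr (- 1 / 4)"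
    by (auto simp: eventually_sequentially)
  have main: "\<exists>T::nat. real T \<le> C * ln (real n) \<and>
      (\<forall>(x0 :: nat \<Rightarrow> bool) (adv :: adversary). eps_bounded n \<epsilon> adv \<longrightarrow>
         measure_pmf.prob (run n 6 3 adv (init_config n x0) T)
           {h. \<exists>b. real (card {u\<in>{..<n}. fst (last h) u = Some b}) \<ge> (1 - 49 / 100) * real n}
         \<ge> 1 - real n powr (- (1 / 4)))" if n: "n \<ge> max 200 (max n1 n2)" for n
  proof -
    have n': "n \<ge> 200" "n \<ge> n1" "n \<ge> n2" using n by auto
    have "exp 1 \<le> (3::real)" by (rule exp_le)
    then have "exp 1 \<le> real n" using n' by linarith
    then have ln1: "1 \<le> ln (real n)" using n' by (subst ln_ge_iff) auto
    \<comment> \<open>Chosen so that \<rho>^t is at most 1/n, which beats the normalising factor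
      sqrt n.\<close>
    define t where "t = nat \<lceil>ln (real n) / L\<rceil>"
    have q: "ln (real n) / L \<ge> 0" using ln1 L by simp
    have t: "ln (real n) / L \<le> real t" "real t \<le> ln (real n) / L + 1" unfolding t_def using q by linarith+
    have T: "real (Suc t) \<le> C * ln (real n)"
      using t(2) ln1 by (simp add: C_def algebra_simps)
    have "\<rho> ^ t = exp (- L * real t)"
      using \<rho> by (simp add: L_def exp_of_nat2_mult)
    also have "\<dots> \<le> exp (- ln (real n))" using t(1) L by (simp add: field_simps)
    also have "\<dots> = 1 / real n" using n' by (simp add: exp_minus field_simps)
    finally have rt: "\<rho> ^ t * sqrt (real n) \<le> 1 / real n * sqrt (real n)" by (intro mult_right_mono) auto
    also have "1 / real n * sqrt (real n) = real n powr (- 1 / 2)"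
      using n' by (simp add: powr_minus powr_half_sqrt field_simps)
    finally have rt: "\<rho> ^ t * sqrt (real n) \<le> real n powr (- 1 / 2)" .
    have tt: "real t * (3000000 / real n) \<le> C * ln (real n) * (3000000 / real n)"
      using T by (intro mult_right_mono) auto
    have "measure_pmf.prob (run n 6 3 adv (init_config n x0) (Suc t))
           {h. \<exists>b. real (card {u\<in>{..<n}. fst (last h) u = Some b}) \<ge> (1 - 49 / 100) * real n}
         \<ge> 1 - real n powr (- (1 / 4))" if adv: "eps_bounded n \<epsilon> adv" for x0 adv
    proof -
      let ?R = "run n 6 3 adv (init_config n x0) (Suc t)"
      let ?U = "{h. \<not> decided n (fst (last h))}"
      have e: "\<epsilon> * real n \<le> real n / 16" using assms(2) mult_right_mono[of \<epsilon> "1 / 16" "real n"] by simp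
      have a: "adv t h \<subseteq> {..<n}" "real (card (adv t h)) \<le> real n / 16" for t h
        using adv e unfolding eps_bounded_def by (blast, meson order_trans)
      have "measure_pmf.prob ?R ?U \<le> \<rho> ^ t * sqrt (real n) + real t * (3000000 / real n)"
        by (rule prob_run_undecided) (use n' \<rho> a drift in auto)
      also have "\<dots> \<le> real n powr (- 1 / 4)" using rt tt n2[OF n'(3)] by linarith
      finally have "1 - real n powr (- (1 / 4)) \<le> 1 - measure_pmf.prob ?R ?U" by simp
      also have "\<dots> = measure_pmf.prob ?R (- ?U)"
        using measure_pmf.prob_compl[of ?U ?R] by (simp add: Compl_eq_Diff_UNIV)
      also have "\<dots> \<le> measure_pmf.prob ?R {h. \<exists>b. real (card {u\<in>{..<n}. fst (last h) u = Some b}) \<ge> (1 - 49 / 100) * real n}"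
        by (rule measure_pmf.finite_measure_mono) (use decided_majority in auto)
      finally show ?thesis .
    qed
    then show ?thesis using T by blast
  qed
  show ?thesis
    by (rule exI[of _ C], rule exI[of _ "49 / 100"], rule exI[of _ "1 / 4"], rule exI[of _ "max 200 (max n1 n2)"])
      (use C main in auto)
qed

end
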